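(* Let $k\to\infty$ and for $i=1,\dots,k$, $t=1,\dots,T_i$, let $x_{it}\in\mathbb{R}^p$ be fixed covariate vectors, with $\max_i T_i$ bounded. Suppose the claim counts are generated by the saturated random effect model: $\{\theta_{it}\}$ are i.i.d. with $E(\theta_{it})=1$ and $\mathrm{Var}(\theta_{it})=\tau^2>0$, and conditionally on the $\theta$'s the $N_{it}$ are independent with $N_{it}\mid\theta_{it}\sim\mathrm{Pois}(\theta_{it}\lambda_{it})$, where $\lambda_{it}=\exp(x_{it}^T\beta)$. Let $\widehat{\beta}$ be the maximum likelihood estimator of $\beta$ in the Poisson regression model $N_{it}\sim\mathrm{Pois}(\lambda_{it})$ (independent), and let $\widehat{\lambda}_{it}=\exp(x_{it}^T\widehat{\beta})$. Assume that $\frac1k\sum_{i}\big(\sum_{t}\lambda_{it}\big)^2$ converges to a positive constant. Consider the score statistic $$\mathcal{T}_{\rm pin}=\frac{\sum_{i}\Big(\big(\sum_{t}(N_{it}-\widehat{\lambda}_{it})\big)^2-\sum_{t}N_{it}\Big)}{\sqrt{2\sum_{i}\big(\sum_{t}\widehat{\lambda}_{it}\big)^2}},$$ and the test that rejects $H_0:\mathrm{Var}(\theta_i)=0$ (in the shared random effect model) when $\mathcal{T}_{\rm pin}$ is at least the $1-\alpha$ quantile of $N(0,1)$. Then this test rejects the null hypothesis with probability tending to one as $k\to\infty$.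
   Context: The shared random effect model is: $N_{it}\mid\theta_i\sim\mathrm{Pois}(\theta_i\lambda_{it})$ with $\theta_i$ i.i.d., mean 1 and variance $\sigma^2$; $H_0$ is $\sigma^2=0$. The statistic $\mathcal{T}_{\rm pin}$ is the score statistic for this $H_0$, which is asymptotically $N(0,1)$ under $H_0$. Here the data are instead generated from the model with a saturated (observation-level) random effect $\theta_{it}$, in which counts from the same policyholder are uncorrelated. *)

theory Defs
  imports "HOL-Probability.Probability"
begin

text \<open>Poisson probability mass function with rate r (r \<ge> 0; for r = 0 it is the point mass at 0).\<close>
definition pois_pmf :: "real \<Rightarrow> nat \<Rightarrow> real" where
  "pois_pmf r n = exp (- r) * r ^ n / fact n"

definition pois_reg_lik ::
  "(nat \<Rightarrow> nat) \<Rightarrow> (nat \<Rightarrow> nat \<Rightarrow> real^'p) \<Rightarrow> nat \<Rightarrow> (nat \<Rightarrow> nat \<Rightarrow> nat) \<Rightarrow> real^'p \<Rightarrow> real" where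
  "pois_reg_lik T x k n b =
     (\<Prod>i\<in>{1..k}. \<Prod>t\<in>{1..T i}. pois_pmf (exp (x i t \<bullet> b)) (n i t))"

definition is_pois_reg_mle ::
  "(nat \<Rightarrow> nat) \<Rightarrow> (nat \<Rightarrow> nat \<Rightarrow> real^'p) \<Rightarrow> nat \<Rightarrow> (nat \<Rightarrow> nat \<Rightarrow> nat) \<Rightarrow> real^'p \<Rightarrow> bool" where
  "is_pois_reg_mle T x k n b \<longleftrightarrow> (\<forall>b'. pois_reg_lik T x k n b' \<le> pois_reg_lik T x k n b)"

definition T_pin ::
  "(nat \<Rightarrow> nat) \<Rightarrow> (nat \<Rightarrow> nat \<Rightarrow> real^'p) \<Rightarrow> nat \<Rightarrow> (nat \<Rightarrow> nat \<Rightarrow> nat) \<Rightarrow> real^'p \<Rightarrow> real" where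
  "T_pin T x k n b =
     (\<Sum>i\<in>{1..k}. (\<Sum>t\<in>{1..T i}. real (n i t) - exp (x i t \<bullet> b))\<^sup>2 - (\<Sum>t\<in>{1..T i}. real (n i t)))
     / sqrt (2 * (\<Sum>i\<in>{1..k}. (\<Sum>t\<in>{1..T i}. exp (x i t \<bullet> b))\<^sup>2))"

end

theory Submission
  imports Defs "HOL-Real_Asymp.Real_Asymp"
begin

text \<open>
  Write \<open>S\<^sub>i\<close> and \<open>\<Lambda>\<^sub>i\<close> for the row sums of \<open>N\<close> and \<open>\<lambda>\<close>, and \<open>u\<^sub>i(b)\<close> for the row sums of
  \<open>exp (x\<^sub>i\<^sub>t \<bullet> b)\<close>. The numerator of the statistic is bounded below uniformly over all
  parameters \<open>b\<close>, hence at the estimator.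
  For fixed \<open>b\<close> the expectation of \<open>\<Sum>\<^sub>i (S\<^sub>i - u\<^sub>i(b))\<^sup>2\<close> is at least
  \<open>\<Sum>\<^sub>i Var S\<^sub>i = \<Sum>\<^sub>i (\<Lambda>\<^sub>i + \<tau>\<^sup>2 \<Sum>\<^sub>t \<lambda>\<^sub>i\<^sub>t\<^sup>2)\<close>, which exceeds \<open>\<Sum>\<^sub>i \<Lambda>\<^sub>i\<close> by a multiple of \<open>k\<close>.

  Uniformity holds because \<open>exp (x\<^sub>i\<^sub>t \<bullet> b) \<ge> r\<close> describes a half-space of parameters: clipping \<open>S\<^sub>i\<close>
  and \<open>u\<^sub>i(b)\<close> at \<open>K (1 + \<Lambda>\<^sub>i)\<close>, which only decreases the squares, and rounding \<open>u\<^sub>i(b)\<close> to a grid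
  leaves polynomially many patterns, and Hoeffding's inequality applies to each of them. Since only
  the average of the \<open>\<Lambda>\<^sub>i\<^sup>2\<close> is controlled and \<open>max\<^sub>i\<^sub>\<le>\<^sub>k \<Lambda>\<^sub>i\<^sup>2 / k\<close> may tend to zero arbitrarily slowly,
  the union bound is taken separately over groups of rows with comparable \<open>\<Lambda>\<^sub>i\<close>, whose number of
  patterns is polynomial in \<open>k / \<Lambda>\<^sub>i\<^sup>2\<close>.
\<close>

section \<open>Counting patterns of half-spaces\<close>

text \<open>Induction on \<open>J\<close>. Adding a half-space can split only those patterns of
  \<open>J\<close> that occur on both sides of its hyperplane \<open>H\<close>, and these already
  occur on \<open>A \<inter> H\<close>, whose dimension is one less. The recursion
  \<open>(n + 1) ^ d + (n + 1) ^ (d - 1) \<le> (n + 2) ^ d\<close> gives the count. Affine sets are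
  allowed in place of the whole space so that the induction hypothesis applies to
  \<open>A \<inter> H\<close>.\<close>

lemma card_halfspace_patterns_affine:
  fixes a :: "'j \<Rightarrow> 'v::euclidean_space" and c :: "'j \<Rightarrow> real"
  assumes "finite J" "affine A" "A \<noteq> {}"
  shows "card ((\<lambda>b. {j\<in>J. c j \<le> a j \<bullet> b}) ` A) \<le> (card J + 1) ^ nat (aff_dim A)"
  using assms
proof (induction J arbitrary: A rule: finite_induct)
  case empty
  then show ?case by (simp add: image_constant_conv)
next
  case (insert j J)
  define pat where "pat = (\<lambda>b. {i\<in>J. c i \<le> a i \<bullet> b})"
  define pat' where "pat' = (\<lambda>b. {i\<in>insert j J. c i \<le> a i \<bullet> b})"
  define A0 where "A0 = A \<inter> {b. a j \<bullet> b < c j}"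
  define A1 where "A1 = A \<inter> {b. c j \<le> a j \<bullet> b}"
  define H where "H = {b. a j \<bullet> b = c j}"
  have fin: "finite (pat ` B)" for B
    by (rule finite_subset[of _ "Pow J"]) (auto simp: pat_def insert.hyps)
  have fin': "finite (pat' ` B)" for B
    by (rule finite_subset[of _ "Pow (insert j J)"]) (auto simp: pat'_def insert.hyps)
  have A01: "A = A0 \<union> A1" by (auto simp: A0_def A1_def)
  then have split: "pat' ` A = pat' ` A0 \<union> pat' ` A1" by auto
  \<comment> \<open>On each side of the hyperplane the membership of \<open>j\<close> is constant,
    so the extended pattern is determined by the pattern over \<open>J\<close>.\<close>
  have "pat' ` A0 = pat ` A0"
    by (rule image_cong) (auto simp: pat_def pat'_def A0_def)
  moreover have "pat' ` A1 = insert j ` pat ` A1"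
    unfolding image_image by (rule image_cong) (auto simp: pat_def pat'_def A1_def)
  ultimately have "card (pat' ` A) \<le> card (pat ` A0) + card (insert j ` pat ` A1)"
    unfolding split using card_Un_le[of "pat' ` A0" "pat' ` A1"] by simp
  also have "\<dots> \<le> card (pat ` A0) + card (pat ` A1)"
    by (intro add_left_mono card_image_le fin)
  \<comment> \<open>Inclusion and exclusion: the excess over the old count is the number of patterns
    seen on both sides.\<close>
  also have "\<dots> = card (pat ` A0 \<union> pat ` A1) + card (pat ` A0 \<inter> pat ` A1)"
    by (rule card_Un_Int) (auto simp: fin)
  also have "pat ` A0 \<union> pat ` A1 = pat ` A"
    using A01 by auto
  finally have count: "card (pat' ` A) \<le> card (pat ` A) + card (pat ` A0 \<inter> pat ` A1)" .
  \<comment> \<open>A pattern realised on both sides of the new hyperplane is realised on it, by convexity.\<close>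
  have inter: "pat ` A0 \<inter> pat ` A1 \<subseteq> pat ` (A \<inter> H)"
  proof
    fix P assume "P \<in> pat ` A0 \<inter> pat ` A1"
    then obtain b0 b1 where b: "b0 \<in> A" "a j \<bullet> b0 < c j" "b1 \<in> A" "c j \<le> a j \<bullet> b1"
      "P = pat b0" "P = pat b1" by (auto simp: A0_def A1_def)
    \<comment> \<open>The parameter at which the segment from \<open>b0\<close> to \<open>b1\<close>
      crosses the hyperplane.\<close>
    define t where "t = (c j - a j \<bullet> b0) / (a j \<bullet> b1 - a j \<bullet> b0)"
    have t: "0 < t" "t \<le> 1" using b by (auto simp: t_def field_simps)
    define b' where "b' = (1 - t) *\<^sub>R b0 + t *\<^sub>R b1"
    have "b' \<in> A" unfolding b'_def
      using insert.prems(1) b by (simp add: affine_alt)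
    have ip: "a i \<bullet> b' = (1 - t) * (a i \<bullet> b0) + t * (a i \<bullet> b1)" for i
      by (simp add: b'_def inner_add_right)
    have "a j \<bullet> b' = a j \<bullet> b0 + t * (a j \<bullet> b1 - a j \<bullet> b0)"
      by (simp add: ip algebra_simps)
    also have "\<dots> = c j" using b by (simp add: t_def)
    finally have "b' \<in> H" by (simp add: H_def)
    \<comment> \<open>A closed half-space and its open complement are both convex, so the side
      shared by the two end points is kept along the segment.\<close>
    have "c i \<le> a i \<bullet> b' \<longleftrightarrow> c i \<le> a i \<bullet> b0" if "i \<in> J" for i
    proof -
      have same: "c i \<le> a i \<bullet> b0 \<longleftrightarrow> c i \<le> a i \<bullet> b1"
        using b(5,6) that by (auto simp: pat_def)
      show ?thesis
      proof (cases "c i \<le> a i \<bullet> b0")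
        case True
        then show ?thesis
          using same t convex_bound_le[of "- (a i \<bullet> b0)" "- c i" "- (a i \<bullet> b1)" "1 - t" t]
          by (simp add: ip)
      next
        case False
        then show ?thesis
          using same t convex_bound_lt[of "a i \<bullet> b0" "c i" "a i \<bullet> b1" "1 - t" t]
          by (simp add: ip)
      qed
    qed
    then have "pat b' = P" using b by (auto simp: pat_def)
    then show "P \<in> pat ` (A \<inter> H)" using \<open>b' \<in> A\<close> \<open>b' \<in> H\<close> by auto
  qed
  let ?n = "card J" and ?d = "nat (aff_dim A)"
  have IH: "card (pat ` A) \<le> (?n + 1) ^ ?d"
    unfolding pat_def by (rule insert.IH) (use insert.prems in auto)
  have cardJ: "card (insert j J) = ?n + 1" using insert.hyps by simp
  have "card (pat' ` A) \<le> (?n + 1 + 1) ^ ?d"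
  \<comment> \<open>In these two cases no pattern occurs on both sides: either the crossing point is
    missing or \<open>A0\<close> is empty. In the remaining case the hyperplane cuts the dimension
    by exactly one.\<close>
  proof (cases "A \<inter> H = {} \<or> A \<subseteq> H")
    case True
    then have "pat ` A0 \<inter> pat ` A1 = {}"
      using inter by (auto simp: A0_def H_def)
    then have "card (pat' ` A) \<le> (?n + 1) ^ ?d" using count IH by simp
    also have "\<dots> \<le> (?n + 1 + 1) ^ ?d" by (intro power_mono) auto
    finally show ?thesis .
  next
    case False
    have H': "affine H" unfolding H_def by (rule affine_hyperplane)
    have d: "aff_dim (A \<inter> H) = aff_dim A - 1"
      using False insert.prems aff_dim_affine_Int_hyperplane[of A "a j" "c j"]
      unfolding H_def by auto
    \<comment> \<open>A nonempty set has nonnegative dimension, so \<open>nat\<close> truncates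
      nothing and the exponent really drops by one.\<close>
    have "0 \<le> aff_dim (A \<inter> H)" using False aff_dim_negative_iff[of "A \<inter> H"] by linarith
    then have d': "?d = Suc (nat (aff_dim (A \<inter> H)))" using d by linarith
    have "card (pat ` A0 \<inter> pat ` A1) \<le> card (pat ` (A \<inter> H))"
      by (rule card_mono[OF fin inter])
    also have "\<dots> \<le> (?n + 1) ^ nat (aff_dim (A \<inter> H))"
      unfolding pat_def by (rule insert.IH) (use insert.prems H' False in \<open>auto intro: affine_Int\<close>)
    finally have "card (pat' ` A) \<le> (?n + 1) ^ ?d + (?n + 1) ^ nat (aff_dim (A \<inter> H))"
      using count IH by linarith
    also have "\<dots> = (?n + 1 + 1) * (?n + 1) ^ nat (aff_dim (A \<inter> H))"
      unfolding d' by simp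
    also have "\<dots> \<le> (?n + 1 + 1) * (?n + 1 + 1) ^ nat (aff_dim (A \<inter> H))"
      by (intro mult_left_mono power_mono) auto
    finally show ?thesis unfolding d' by simp
  qed
  then show ?case unfolding cardJ pat'_def .
qed

lemma card_halfspace_patterns:
  fixes a :: "'j \<Rightarrow> 'v::euclidean_space" and c :: "'j \<Rightarrow> real"
  assumes "finite J"
  shows "card (range (\<lambda>b. {j\<in>J. c j \<le> a j \<bullet> b})) \<le> (card J + 1) ^ DIM('v)"
  using card_halfspace_patterns_affine[OF assms, of UNIV c a] by simp

section \<open>Poisson moments, quantisation and averages\<close>

lemma pois_pmf_nonneg: "0 \<le> r \<Longrightarrow> 0 \<le> pois_pmf r n"
  by (simp add: pois_pmf_def)

lemma pois_pmf_sums: "pois_pmf r sums 1"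
proof -
  have "(\<lambda>n. exp (- r) * (r ^ n /\<^sub>R fact n)) sums (exp (- r) * exp r)"
    by (intro sums_mult exp_converges)
  also have "(\<lambda>n. exp (- r) * (r ^ n /\<^sub>R fact n)) = pois_pmf r"
    by (simp add: pois_pmf_def fun_eq_iff field_simps)
  finally show ?thesis by (simp add: exp_minus_inverse mult.commute)
qed

text \<open>The weights satisfy \<open>(n + 1) * p (n + 1) = r * p n\<close>, hence E(N f(N)) = r
  E(f(N + 1)). Taking \<open>f\<close> to be successive powers yields the moments
  recursively.\<close>

lemma pois_pmf_size_bias_sums:
  assumes "(\<lambda>n. pois_pmf r n * f (Suc n)) sums a"
  shows "(\<lambda>n. pois_pmf r n * (real n * f n)) sums (r * a)"
proof -
  have "pois_pmf r (Suc n) * (real (Suc n) * f (Suc n)) = r * (pois_pmf r n * f (Suc n))" for n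
    by (simp add: pois_pmf_def field_simps del: of_nat_Suc)
  then have "(\<lambda>n. pois_pmf r (Suc n) * (real (Suc n) * f (Suc n))) sums (r * a)"
    using sums_mult[OF assms, of r] by (simp only:)
  then show ?thesis by (subst (asm) sums_Suc_iff) simp
qed

lemma pois_pmf_first_moment: "(\<lambda>n. pois_pmf r n * real n) sums r"
  using pois_pmf_size_bias_sums[of r "\<lambda>_. 1" 1] pois_pmf_sums[of r] by simp

lemma pois_pmf_second_moment: "(\<lambda>n. pois_pmf r n * (real n)\<^sup>2) sums (r\<^sup>2 + r)"
proof -
  have "(\<lambda>n. pois_pmf r n * real n + pois_pmf r n) sums (r + 1)"
    by (intro sums_add pois_pmf_first_moment pois_pmf_sums)
  then have "(\<lambda>n. pois_pmf r n * real (Suc n)) sums (r + 1)"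
    by (simp add: algebra_simps)
  from pois_pmf_size_bias_sums[of _ real, OF this] show ?thesis
    by (simp add: power2_eq_square algebra_simps)
qed

lemma pois_pmf_third_moment: "(\<lambda>n. pois_pmf r n * real n ^ 3) sums (r ^ 3 + 3 * r\<^sup>2 + r)"
proof -
  have "(\<lambda>n. pois_pmf r n * (real n)\<^sup>2 + 2 * (pois_pmf r n * real n) + pois_pmf r n)
      sums ((r\<^sup>2 + r) + 2 * r + 1)"
    by (intro sums_add sums_mult pois_pmf_first_moment pois_pmf_second_moment pois_pmf_sums)
  then have "(\<lambda>n. pois_pmf r n * (real (Suc n))\<^sup>2) sums ((r\<^sup>2 + r) + 2 * r + 1)"
    by (simp add: algebra_simps power2_eq_square)
  from pois_pmf_size_bias_sums[of _ "\<lambda>n. (real n)\<^sup>2", OF this] show ?thesis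
    by (simp add: power2_eq_square power3_eq_cube algebra_simps)
qed

text \<open>The count of levels is the floor of \<open>u / g\<close> capped at \<open>L\<close>, so
  \<open>q\<close> is \<open>u\<close> rounded down to the grid and capped at its top. It is written
  as a count because each condition \<open>real l * g \<le> u\<close> becomes a half-space condition
  on the parameter when \<open>u\<close> is an exponential rate.\<close>

lemma quantisation_error:
  fixes u g :: real and L :: nat
  assumes "0 < u" "0 < g"
  defines "q \<equiv> g * real (card {l\<in>{1..L}. real l * g \<le> u})"
  shows "q \<le> min u (g * real L)" "min u (g * real L) - g \<le> q"
proof -
  define m where "m = nat \<lfloor>u / g\<rfloor>"
  have m: "real m \<le> u / g" "u / g < real m + 1"
    using assms by (auto simp: m_def)
  have "l \<le> m \<longleftrightarrow> real l * g \<le> u" for l :: nat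
  proof -
    have "l \<le> m \<longleftrightarrow> real l \<le> u / g" using m by linarith
    then show ?thesis using assms by (simp add: field_simps)
  qed
  then have "{l\<in>{1..L}. real l * g \<le> u} = {l\<in>{1..L}. l \<le> m}" by presburger
  also have "\<dots> = {1..min L m}" by auto
  finally have "{l\<in>{1..L}. real l * g \<le> u} = {1..min L m}" .
  then have q: "q = g * real (min L m)" by (simp add: q_def)
  have 1: "g * real m \<le> u" "u \<le> g * real m + g" using m assms by (auto simp: field_simps)
  show "q \<le> min u (g * real L)"
  proof -
    have "g * real (min L m) \<le> g * real L" "g * real (min L m) \<le> g * real m"
      using assms by auto
    then show ?thesis unfolding q using 1 by linarith
  qed
  show "min u (g * real L) - g \<le> q"
    unfolding q using 1 assms by (auto simp: min_def)
qed

text \<open>Rounding costs at most \<open>g\<close> per term. Capping the single terms costs nothing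
  further, since the sum is capped at the same height.\<close>

lemma sum_quantisation_error:
  fixes u :: "'t \<Rightarrow> real" and g :: real and L :: nat
  assumes "finite I" "\<And>t. t \<in> I \<Longrightarrow> 0 < u t" "0 < g"
  defines "q \<equiv> \<lambda>t. g * real (card {l\<in>{1..L}. real l * g \<le> u t})"
  shows "\<bar>min (\<Sum>t\<in>I. q t) (g * real L) - min (\<Sum>t\<in>I. u t) (g * real L)\<bar> \<le> real (card I) * g"
proof -
  have q: "q t \<le> min (u t) (g * real L)" "min (u t) (g * real L) - g \<le> q t" if "t \<in> I" for t
    using quantisation_error[of "u t" g L] assms that by (auto simp: q_def)
  have up: "(\<Sum>t\<in>I. q t) \<le> (\<Sum>t\<in>I. u t)"
    using q(1) by (intro sum_mono) auto
  have "min (\<Sum>t\<in>I. u t) (g * real L) \<le> (\<Sum>t\<in>I. min (u t) (g * real L))"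
  \<comment> \<open>Either one term alone reaches the cap, or no term is capped at all.\<close>
  proof (cases "\<exists>t\<in>I. g * real L \<le> u t")
    case True
    then obtain t where t: "t \<in> I" "g * real L \<le> u t" by auto
    have "min (u t) (g * real L) \<le> (\<Sum>t\<in>I. min (u t) (g * real L))"
      using assms t by (intro member_le_sum) (auto simp: less_imp_le)
    then show ?thesis using t by simp
  next
    case False
    then have "(\<Sum>t\<in>I. min (u t) (g * real L)) = (\<Sum>t\<in>I. u t)"
      by (intro sum.cong) auto
    then show ?thesis by simp
  qed
  also have "\<dots> \<le> (\<Sum>t\<in>I. q t + g)"
    using q(2) by (intro sum_mono) (auto simp: algebra_simps)
  also have "\<dots> = (\<Sum>t\<in>I. q t) + real (card I) * g"
    by (simp add: sum.distrib)
  finally show ?thesis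
    using up assms(3) by (auto simp: min_def abs_if split: if_splits)
qed

text \<open>The minimum with a fixed bound is a 1-Lipschitz map.\<close>

lemma clip_square_le:
  fixes S u B :: real
  shows "(min S B - min u B)\<^sup>2 \<le> (S - u)\<^sup>2"
proof -
  have "\<bar>min S B - min u B\<bar> \<le> \<bar>S - u\<bar>" by (simp add: min_def)
  then show ?thesis by (rule abs_le_square_iff[THEN iffD1])
qed

text \<open>With \<open>A\<close> the sequence of averages, \<open>a (k + 1) / (k + 1)\<close>
  equals \<open>A (k + 1) - k / (k + 1) * A k\<close> and so tends to zero. This controls the late
  terms; the finitely many early ones are bounded by a constant.\<close>

lemma terms_sublinear_if_averages_converge:
  fixes a :: "nat \<Rightarrow> real"
  assumes nonneg: "\<And>i. 0 \<le> a i"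
    and lim: "(\<lambda>k. (1 / real k) * (\<Sum>i\<in>{1..k}. a i)) \<longlonglongrightarrow> c"
    and "0 < \<epsilon>"
  shows "\<forall>\<^sub>F k in sequentially. \<forall>i\<in>{1..k}. a i \<le> \<epsilon> * real k"
proof -
  define A where "A = (\<lambda>k. (1 / real k) * (\<Sum>i\<in>{1..k}. a i))"
  have A: "A \<longlonglongrightarrow> c" using lim by (simp add: A_def)
  have A': "(\<lambda>k. A (Suc k)) \<longlonglongrightarrow> c" using A by (rule LIMSEQ_Suc)
  have r: "(\<lambda>k. real k / real (Suc k)) \<longlonglongrightarrow> 1" by real_asymp
  have "(\<lambda>k. A (Suc k) - real k / real (Suc k) * A k) \<longlonglongrightarrow> c - 1 * c"
    by (intro tendsto_diff tendsto_mult A A' r)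
  moreover have "A (Suc k) - real k / real (Suc k) * A k = a (Suc k) / real (Suc k)" for k
    by (cases "k = 0") (auto simp: A_def add_divide_distrib)
  ultimately have "(\<lambda>k. a (Suc k) / real (Suc k)) \<longlonglongrightarrow> 0" by simp
  then have "(\<lambda>k. a k / real k) \<longlonglongrightarrow> 0" by (subst (asm) filterlim_sequentially_Suc)
  then have "\<forall>\<^sub>F k in sequentially. a k / real k < \<epsilon>"
    using \<open>0 < \<epsilon>\<close> by (auto dest: order_tendstoD(2))
  then obtain n0 where n0: "\<And>i. n0 \<le> i \<Longrightarrow> a i / real i < \<epsilon>"
    by (auto simp: eventually_sequentially)
  define R where "R = (\<Sum>i<n0. a i)"
  have "\<forall>\<^sub>F k in sequentially. R \<le> \<epsilon> * real k"
    using \<open>0 < \<epsilon>\<close> by real_asymp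
  then show ?thesis
  proof eventually_elim
    case (elim k)
    show ?case
    proof
      fix i assume i: "i \<in> {1..k}"
      show "a i \<le> \<epsilon> * real k"
      proof (cases "i < n0")
        case True
        then have "a i \<le> R" unfolding R_def using nonneg by (intro member_le_sum) auto
        then show ?thesis using elim by simp
      next
        case False
        then have "a i \<le> \<epsilon> * real i" using n0[of i] i by (auto simp: field_simps)
        also have "\<dots> \<le> \<epsilon> * real k" using i \<open>0 < \<epsilon>\<close> by (intro mult_left_mono) auto
        finally show ?thesis .
      qed
    qed
  qed
qed

section \<open>Uniform deviations over classes of polynomial growth\<close>

lemma (in prob_space) square_integrable_mult:
  fixes X Y :: "'a \<Rightarrow> real"
  assumes [measurable]: "random_variable borel X" "random_variable borel Y"
    and "integrable M (\<lambda>\<omega>. (X \<omega>)\<^sup>2)" "integrable M (\<lambda>\<omega>. (Y \<omega>)\<^sup>2)"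
  shows "integrable M (\<lambda>\<omega>. X \<omega> * Y \<omega>)"
proof (rule Bochner_Integration.integrable_bound)
  show "integrable M (\<lambda>\<omega>. (X \<omega>)\<^sup>2 + (Y \<omega>)\<^sup>2)" using assms by auto
  show "AE \<omega> in M. norm (X \<omega> * Y \<omega>) \<le> norm ((X \<omega>)\<^sup>2 + (Y \<omega>)\<^sup>2)"
  proof (rule AE_I2)
    fix \<omega>
    have "2 * \<bar>X \<omega> * Y \<omega>\<bar> \<le> (X \<omega>)\<^sup>2 + (Y \<omega>)\<^sup>2"
      using sum_squares_bound[of "\<bar>X \<omega>\<bar>" "\<bar>Y \<omega>\<bar>"] by (simp add: abs_mult)
    then show "norm (X \<omega> * Y \<omega>) \<le> norm ((X \<omega>)\<^sup>2 + (Y \<omega>)\<^sup>2)" by simp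
  qed
qed measurable

text \<open>Bienayme's identity: after centring, the mixed products have mean zero by pairwise
  independence.\<close>

lemma (in prob_space) variance_sum_indep:
  fixes X :: "'i \<Rightarrow> 'a \<Rightarrow> real" and m :: "'i \<Rightarrow> real"
  assumes fin: "finite I" and indep: "indep_vars (\<lambda>_. borel) X I"
    and sq: "\<And>i. i \<in> I \<Longrightarrow> integrable M (\<lambda>\<omega>. (X i \<omega>)\<^sup>2)"
    and m: "\<And>i. i \<in> I \<Longrightarrow> expectation (X i) = m i"
  shows "integrable M (\<lambda>\<omega>. (\<Sum>i\<in>I. X i \<omega>)\<^sup>2)"
    and "expectation (\<lambda>\<omega>. ((\<Sum>i\<in>I. X i \<omega>) - (\<Sum>i\<in>I. m i))\<^sup>2)
       = (\<Sum>i\<in>I. expectation (\<lambda>\<omega>. (X i \<omega> - m i)\<^sup>2))"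
proof -
  have rv: "random_variable borel (X i)" if "i \<in> I" for i
    using indep that by (auto simp: indep_vars_def)
  have int: "integrable M (X i)" if "i \<in> I" for i
    using square_integrable_imp_integrable[OF rv[OF that] sq[OF that]] .
  have "integrable M (\<lambda>\<omega>. \<Sum>i\<in>I. \<Sum>j\<in>I. X i \<omega> * X j \<omega>)"
    by (intro Bochner_Integration.integrable_sum square_integrable_mult rv sq)
  then show "integrable M (\<lambda>\<omega>. (\<Sum>i\<in>I. X i \<omega>)\<^sup>2)"
    by (simp add: power2_eq_square sum_product)
  define Z where "Z = (\<lambda>i \<omega>. X i \<omega> - m i)"
  have Zrv: "random_variable borel (Z i)" if "i \<in> I" for i
    using rv[OF that] by (simp add: Z_def)
  have Zsq: "integrable M (\<lambda>\<omega>. (Z i \<omega>)\<^sup>2)" if "i \<in> I" for i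
    unfolding Z_def power2_diff using sq[OF that] int[OF that] by auto
  have Zint: "integrable M (Z i)" "expectation (Z i) = 0" if "i \<in> I" for i
    using int[OF that] m[OF that] by (auto simp: Z_def prob_space)
  have Zindep: "indep_vars (\<lambda>_. borel) Z I"
    unfolding Z_def by (rule indep_vars_compose2[OF indep, where Y = "\<lambda>i x. x - m i"]) auto
  have cross: "expectation (\<lambda>\<omega>. Z i \<omega> * Z j \<omega>) = (if j = i then expectation (\<lambda>\<omega>. (Z i \<omega>)\<^sup>2) else 0)"
    if "i \<in> I" "j \<in> I" for i j
  proof (cases "i = j")
    case False
    have "indep_vars (\<lambda>_. borel) Z {i, j}"
      by (rule indep_vars_subset[OF Zindep]) (use that in auto)
    then have "expectation (\<lambda>\<omega>. \<Prod>k\<in>{i, j}. Z k \<omega>) = (\<Prod>k\<in>{i, j}. expectation (Z k))"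
      by (intro indep_vars_lebesgue_integral) (use Zint that in auto)
    then show ?thesis using False Zint that by simp
  qed (simp add: power2_eq_square)
  have "expectation (\<lambda>\<omega>. ((\<Sum>i\<in>I. X i \<omega>) - (\<Sum>i\<in>I. m i))\<^sup>2)
      = expectation (\<lambda>\<omega>. \<Sum>i\<in>I. \<Sum>j\<in>I. Z i \<omega> * Z j \<omega>)"
    unfolding Z_def sum_subtractf[symmetric] power2_eq_square sum_product ..
  also have "\<dots> = (\<Sum>i\<in>I. \<Sum>j\<in>I. expectation (\<lambda>\<omega>. Z i \<omega> * Z j \<omega>))"
  proof -
    have *: "integrable M (\<lambda>\<omega>. Z i \<omega> * Z j \<omega>)" if "i \<in> I" "j \<in> I" for i j
      using that by (intro square_integrable_mult Zrv Zsq)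
    show ?thesis by (simp add: Bochner_Integration.integral_sum *)
  qed
  also have "\<dots> = (\<Sum>i\<in>I. \<Sum>j\<in>I. if j = i then expectation (\<lambda>\<omega>. (Z i \<omega>)\<^sup>2) else 0)"
    by (intro sum.cong refl cross)
  also have "\<dots> = (\<Sum>i\<in>I. expectation (\<lambda>\<omega>. (Z i \<omega>)\<^sup>2))"
    using fin by (simp add: sum.delta)
  finally show "expectation (\<lambda>\<omega>. ((\<Sum>i\<in>I. X i \<omega>) - (\<Sum>i\<in>I. m i))\<^sup>2)
       = (\<Sum>i\<in>I. expectation (\<lambda>\<omega>. (X i \<omega> - m i)\<^sup>2))"
    by (simp add: Z_def)
qed

section \<open>Hoeffding's inequality over finitely many patterns\<close>

context prob_space
begin

text \<open>The inequality sees \<open>b\<close> only through the values \<open>v i b\<close> with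
  \<open>i\<close> in \<open>G\<close>. The union over all parameters is therefore a finite union
  over patterns, which also gives measurability.\<close>

lemma square_deviation_event:
  fixes Y :: "'i \<Rightarrow> 'a \<Rightarrow> real" and v :: "'i \<Rightarrow> 'b \<Rightarrow> real"
  assumes rv: "\<And>i. i \<in> G \<Longrightarrow> random_variable borel (Y i)"
    and fin: "finite (range (\<lambda>b. restrict (\<lambda>i. v i b) G))"
  defines "F \<equiv> range (\<lambda>b. restrict (\<lambda>i. v i b) G)"
  shows "{\<omega>\<in>space M. \<exists>b. (\<Sum>i\<in>G. (Y i \<omega> - v i b)\<^sup>2)
            < (\<Sum>i\<in>G. expectation (\<lambda>\<omega>. (Y i \<omega> - v i b)\<^sup>2)) - e}
       = (\<Union>w\<in>F. {\<omega>\<in>space M. (\<Sum>i\<in>G. (Y i \<omega> - w i)\<^sup>2)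
            < (\<Sum>i\<in>G. expectation (\<lambda>\<omega>. (Y i \<omega> - w i)\<^sup>2)) - e})" (is ?eq)
    and "{\<omega>\<in>space M. \<exists>b. (\<Sum>i\<in>G. (Y i \<omega> - v i b)\<^sup>2)
            < (\<Sum>i\<in>G. expectation (\<lambda>\<omega>. (Y i \<omega> - v i b)\<^sup>2)) - e} \<in> events" (is ?ev)
proof -
  show eq: ?eq by (auto simp: F_def)
  show ?ev
    unfolding eq by (intro sets.finite_UN) (use fin rv in \<open>auto simp: F_def\<close>)
qed

text \<open>For a fixed pattern the summands are independent with values in
  \<open>[0, (B i)\<^sup>2]\<close>, so Hoeffding's inequality has the sum of the
  \<open>B i ^ 4\<close> in its denominator. A union bound over the patterns follows.\<close>

lemma square_deviation_union_bound:
  fixes Y :: "'i \<Rightarrow> 'a \<Rightarrow> real" and v :: "'i \<Rightarrow> 'b \<Rightarrow> real"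
  assumes G: "finite G" and indep: "indep_vars (\<lambda>_. borel) Y G"
    and Y: "\<And>i \<omega>. i \<in> G \<Longrightarrow> \<omega> \<in> space M \<Longrightarrow> 0 \<le> Y i \<omega> \<and> Y i \<omega> \<le> B i"
    and v: "\<And>i b. i \<in> G \<Longrightarrow> 0 \<le> v i b \<and> v i b \<le> B i"
    and fin: "finite (range (\<lambda>b. restrict (\<lambda>i. v i b) G))"
    and B: "\<And>i. i \<in> G \<Longrightarrow> 0 < B i" and V: "(\<Sum>i\<in>G. B i ^ 4) \<le> V" and e: "0 \<le> e"
  shows "prob {\<omega>\<in>space M. \<exists>b. (\<Sum>i\<in>G. (Y i \<omega> - v i b)\<^sup>2)
            < (\<Sum>i\<in>G. expectation (\<lambda>\<omega>. (Y i \<omega> - v i b)\<^sup>2)) - e}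
       \<le> real (card (range (\<lambda>b. restrict (\<lambda>i. v i b) G))) * exp (- 2 * e\<^sup>2 / V)"
\<comment> \<open>Without rows both sums vanish and the event is empty because \<open>e\<close> is
  nonnegative. Otherwise the denominator in Hoeffding's bound is positive.\<close>
proof (cases "G = {}")
  case True
  then show ?thesis using e by simp
next
  case False
  have rv: "random_variable borel (Y i)" if "i \<in> G" for i
    using indep that by (auto simp: indep_vars_def)
  define F where "F = range (\<lambda>b. restrict (\<lambda>i. v i b) G)"
  define E where "E = (\<lambda>w. {\<omega>\<in>space M. (\<Sum>i\<in>G. (Y i \<omega> - w i)\<^sup>2)
            < (\<Sum>i\<in>G. expectation (\<lambda>\<omega>. (Y i \<omega> - w i)\<^sup>2)) - e})"
  have E: "E w \<in> events" for w
    unfolding E_def using rv by measurable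
  have "prob (E w) \<le> exp (- 2 * e\<^sup>2 / V)" if "w \<in> F" for w
  proof -
    have w: "0 \<le> w i \<and> w i \<le> B i" if "i \<in> G" for i
      using \<open>w \<in> F\<close> v that by (auto simp: F_def)
    have bd: "(Y i \<omega> - w i)\<^sup>2 \<le> (B i)\<^sup>2" if "i \<in> G" "\<omega> \<in> space M" for i \<omega>
    proof -
      have "\<bar>Y i \<omega> - w i\<bar> \<le> \<bar>B i\<bar>" using w[OF that(1)] Y[OF that] by linarith
      then show ?thesis by (rule abs_le_square_iff[THEN iffD1])
    qed
    interpret H: Hoeffding_ineq M G "\<lambda>i \<omega>. (Y i \<omega> - w i)\<^sup>2" "\<lambda>_. 0" "\<lambda>i. (B i)\<^sup>2"
      "\<Sum>i\<in>G. expectation (\<lambda>\<omega>. (Y i \<omega> - w i)\<^sup>2)"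
    proof unfold_locales
      show "indep_vars (\<lambda>_. borel) (\<lambda>i \<omega>. (Y i \<omega> - w i)\<^sup>2) G"
        by (rule indep_vars_compose2[OF indep, where Y = "\<lambda>i x. (x - w i)\<^sup>2"]) auto
      show "AE \<omega> in M. (Y i \<omega> - w i)\<^sup>2 \<in> {0..(B i)\<^sup>2}" if "i \<in> G" for i
        using bd[OF that] by (intro AE_I2) auto
    qed (use G in auto)
    have sum4: "(\<Sum>i\<in>G. ((B i)\<^sup>2 - 0)\<^sup>2) = (\<Sum>i\<in>G. B i ^ 4)"
      by (simp flip: power_mult)
    have pos: "0 < (\<Sum>i\<in>G. B i ^ 4)"
      using False G B by (intro sum_pos zero_less_power) auto
    have "prob (E w) \<le> prob {\<omega>\<in>space M. (\<Sum>i\<in>G. (Y i \<omega> - w i)\<^sup>2)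
            \<le> (\<Sum>i\<in>G. expectation (\<lambda>\<omega>. (Y i \<omega> - w i)\<^sup>2)) - e}"
      by (rule finite_measure_mono) (use rv in \<open>auto simp: E_def\<close>)
    also have "\<dots> \<le> exp (- 2 * e\<^sup>2 / (\<Sum>i\<in>G. B i ^ 4))"
      using H.Hoeffding_ineq_le[OF e] pos unfolding sum4 by simp
    also have "\<dots> \<le> exp (- 2 * e\<^sup>2 / V)"
      using V pos by (simp add: divide_left_mono)
    finally show ?thesis .
  qed
  then have "(\<Sum>w\<in>F. prob (E w)) \<le> (\<Sum>w\<in>F. exp (- 2 * e\<^sup>2 / V))" by (intro sum_mono)
  moreover have "prob (\<Union>w\<in>F. E w) \<le> (\<Sum>w\<in>F. prob (E w))"
    by (rule finite_measure_subadditive_finite) (use fin E in \<open>auto simp: F_def\<close>)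
  ultimately have "prob (\<Union>w\<in>F. E w) \<le> real (card F) * exp (- 2 * e\<^sup>2 / V)" by simp
  then show ?thesis
    by (subst square_deviation_event(1)[OF rv fin]) (simp_all add: F_def E_def)
qed

end

text \<open>The number of patterns in a group is polynomial in \<open>r\<close> and its Hoeffding
  factor is Gaussian in \<open>r\<close>; the decay \<open>1 / r\<close> suffices to sum over
  groups. The exponent \<open>n = 4 * p + 1\<close> leaves room for one more factor
  \<open>r\<close>, and \<open>x ^ n / exp x\<close> is used at
  \<open>x = r\<^sup>2 / c\<close>.\<close>

lemma poly_times_gaussian_eventually_le:
  fixes a c :: real
  assumes "0 \<le> a" "0 < c"
  shows "\<forall>\<^sub>F r in at_top. (a * r ^ 4 + 1) ^ p * exp (- (r\<^sup>2 / c)) \<le> 1 / r"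
proof -
  define n where "n = 4 * p + 1"
  have "((\<lambda>x::real. x ^ n / exp x) \<longlongrightarrow> 0) at_top"
    by (rule tendsto_power_div_exp_0)
  moreover have "filterlim (\<lambda>r::real. r\<^sup>2 / c) at_top at_top"
    using assms by real_asymp
  ultimately have "((\<lambda>r. (r\<^sup>2 / c) ^ n / exp (r\<^sup>2 / c)) \<longlongrightarrow> 0) at_top"
    by (rule filterlim_compose)
  then have "((\<lambda>r. ((a + 1) ^ p * c ^ n) * ((r\<^sup>2 / c) ^ n / exp (r\<^sup>2 / c))) \<longlongrightarrow> ((a + 1) ^ p * c ^ n) * 0) at_top"
    by (intro tendsto_mult tendsto_const)
  then have "\<forall>\<^sub>F r in at_top. ((a + 1) ^ p * c ^ n) * ((r\<^sup>2 / c) ^ n / exp (r\<^sup>2 / c)) < 1"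
    by (intro order_tendstoD(2)) auto
  then show ?thesis
    using eventually_ge_at_top[of 1]
  proof eventually_elim
    case (elim r)
    have "(a * r ^ 4 + 1) ^ p \<le> ((a + 1) * r ^ 4) ^ p"
      using elim assms by (intro power_mono) (auto simp: algebra_simps)
    also have "\<dots> = (a + 1) ^ p * r ^ (4 * p)" by (simp add: power_mult_distrib power_mult)
    finally have "r * (a * r ^ 4 + 1) ^ p \<le> (a + 1) ^ p * r ^ n"
      using elim mult_left_mono[of "(a * r ^ 4 + 1) ^ p" "(a + 1) ^ p * r ^ (4 * p)" r]
      by (simp add: n_def mult_ac)
    also have "\<dots> \<le> (a + 1) ^ p * (r\<^sup>2) ^ n"
      using elim assms by (intro mult_left_mono power_mono) (auto simp: power2_eq_square)
    finally have "r * (a * r ^ 4 + 1) ^ p * exp (- (r\<^sup>2 / c)) \<le> (a + 1) ^ p * (r\<^sup>2) ^ n * exp (- (r\<^sup>2 / c))"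
      by (intro mult_right_mono) auto
    also have "\<dots> = ((a + 1) ^ p * c ^ n) * ((r\<^sup>2 / c) ^ n / exp (r\<^sup>2 / c))"
      using assms by (simp add: exp_minus power_divide field_simps)
    finally have "r * (a * r ^ 4 + 1) ^ p * exp (- (r\<^sup>2 / c)) \<le> 1"
      using elim by linarith
    then show ?case using elim by (simp add: field_simps)
  qed
qed

context prob_space
begin

text \<open>Rows with \<open>s i\<close> between \<open>4 ^ j\<close> and \<open>4 ^ (j + 1)\<close>
  form group \<open>j\<close>. Since the sum of the \<open>(s i)\<^sup>2\<close> is at most
  \<open>C * k\<close>, the group has at most \<open>C * r ^ 4\<close> rows, where
  \<open>r ^ 4 = k / 16 ^ j\<close>. A deviation of \<open>k / r\<close> is allowed to it, which
  makes the Hoeffding exponent \<open>r\<^sup>2 / (8 * C * K ^ 4)\<close> and the failure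
  probability at most \<open>1 / r\<close>. As \<open>1 / r = 2 ^ j / q\<close>, deviations and
  probabilities are both geometric in \<open>j\<close>, dominated by the largest rows, and small
  because these are of order below the square root of \<open>k\<close>.\<close>

lemma uniform_square_deviation_tendsto_0:
  fixes Y :: "nat \<Rightarrow> 'a \<Rightarrow> real" and v :: "nat \<Rightarrow> 'b \<Rightarrow> real" and s :: "nat \<Rightarrow> real"
    and A p :: nat and K C \<eta> :: real
  assumes indep: "indep_vars (\<lambda>_. borel) Y {1..}"
    and Y: "\<And>i \<omega>. 1 \<le> i \<Longrightarrow> \<omega> \<in> space M \<Longrightarrow> 0 \<le> Y i \<omega> \<and> Y i \<omega> \<le> K * s i"
    and v: "\<And>i b. 1 \<le> i \<Longrightarrow> 0 \<le> v i b \<and> v i b \<le> K * s i"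
    and K: "0 < K" and s: "\<And>i. 1 \<le> s i"
    and fin: "\<And>G. finite G \<Longrightarrow> G \<subseteq> {1..} \<Longrightarrow> finite (range (\<lambda>b. restrict (\<lambda>i. v i b) G))"
    and growth: "\<And>G. finite G \<Longrightarrow> G \<subseteq> {1..} \<Longrightarrow>
       card (range (\<lambda>b. restrict (\<lambda>i. v i b) G)) \<le> (A * card G + 1) ^ p"
    and C: "0 < C" "\<forall>\<^sub>F k in sequentially. (\<Sum>i\<in>{1..k}. (s i)\<^sup>2) \<le> C * real k"
    and max: "\<And>\<epsilon>. 0 < \<epsilon> \<Longrightarrow> \<forall>\<^sub>F k in sequentially. \<forall>i\<in>{1..k}. (s i)\<^sup>2 \<le> \<epsilon> * real k"
    and \<eta>: "0 < \<eta>"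
  shows "(\<lambda>k. prob {\<omega>\<in>space M. \<exists>b. (\<Sum>i\<in>{1..k}. (Y i \<omega> - v i b)\<^sup>2)
            < (\<Sum>i\<in>{1..k}. expectation (\<lambda>\<omega>. (Y i \<omega> - v i b)\<^sup>2)) - \<eta> * real k}) \<longlonglongrightarrow> 0"
    (is "?P \<longlonglongrightarrow> 0")
proof (rule tendstoI)
  fix e :: real assume e: "0 < e"
  have rv: "random_variable borel (Y i)" if "1 \<le> i" for i
    using indep that by (auto simp: indep_vars_def)
  have "\<forall>\<^sub>F r in at_top. (real A * C * r ^ 4 + 1) ^ p * exp (- (r\<^sup>2 / (8 * C * K ^ 4))) \<le> 1 / r"
    using C K by (intro poly_times_gaussian_eventually_le) auto
  then obtain r0 where r0: "\<And>r. r0 \<le> r \<Longrightarrow>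
      (real A * C * r ^ 4 + 1) ^ p * exp (- (r\<^sup>2 / (8 * C * K ^ 4))) \<le> 1 / r"
    by (auto simp: eventually_at_top_linorder)
  \<comment> \<open>The first bound brings every group into the range \<open>r0 \<le> r\<close>, the
    second keeps the total deviation below \<open>\<eta> * k\<close>, the third keeps the total
    probability below \<open>e\<close>.\<close>
  define \<epsilon> where "\<epsilon> = min (1 / max r0 1) (min (\<eta> / 2) (e / 3))"
  have \<epsilon>: "0 < \<epsilon>" "\<epsilon> \<le> 1 / max r0 1" "2 * \<epsilon> \<le> \<eta>" "2 * \<epsilon> < e"
    using \<eta> e by (auto simp: \<epsilon>_def)
  have "\<forall>\<^sub>F k in sequentially. \<forall>i\<in>{1..k}. (s i)\<^sup>2 \<le> \<epsilon> ^ 4 * real k"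
    using \<epsilon> by (intro max) auto
  then show "\<forall>\<^sub>F k in sequentially. dist (?P k) 0 < e"
    using C(2) eventually_ge_at_top[of "1::nat"]
  proof eventually_elim
    case (elim k)
    \<comment> \<open>Since \<open>1 \<le> s i\<close>, the logarithm is nonnegative and
      \<open>nat\<close> loses nothing. Base four is convenient because
      \<open>(4 ^ j)\<^sup>2 = (2 ^ j) ^ 4\<close>, which matches the fourth root
      \<open>q\<close>.\<close>
    define lev where "lev = (\<lambda>i. nat \<lfloor>log 4 (s i)\<rfloor>)"
    have lev: "4 ^ lev i \<le> s i" "s i < 4 ^ (lev i + 1)" for i
    proof -
      have "0 \<le> log 4 (s i)" using s[of i] by simp
      then have "real (lev i) \<le> log 4 (s i)" "log 4 (s i) < real (lev i + 1)"
        unfolding lev_def by linarith+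
      then show "4 ^ lev i \<le> s i" "s i < 4 ^ (lev i + 1)"
        using s[of i] by (auto simp: le_log_iff log_less_iff powr_realpow[symmetric] simp del: power_Suc of_nat_add)
    qed
    define J where "J = Max (lev ` {1..k})"
    define q where "q = root 4 (real k)"
    have q: "0 < q" "q ^ 4 = real k"
      using elim by (auto simp: q_def)
    define G where "G = (\<lambda>j. {i\<in>{1..k}. lev i = j})"
    define dev where "dev = (\<lambda>j::nat. real k * 2 ^ j / q)"
    define E where "E = (\<lambda>j. {\<omega>\<in>space M. \<exists>b. (\<Sum>i\<in>G j. (Y i \<omega> - v i b)\<^sup>2)
            < (\<Sum>i\<in>G j. expectation (\<lambda>\<omega>. (Y i \<omega> - v i b)\<^sup>2)) - dev j})"
    have G: "finite (G j)" "G j \<subseteq> {1..}" "G j \<subseteq> {1..k}" for j by (auto simp: G_def)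
    have rvG: "random_variable borel (Y i)" if "i \<in> G j" for i j
      using that by (intro rv) (auto simp: G_def)
    have E_ev: "E j \<in> events" for j
      unfolding E_def by (rule square_deviation_event(2)[OF rvG fin[OF G(1,2)]])
    have "J \<in> lev ` {1..k}"
      unfolding J_def using elim by (intro Max_in) auto
    \<comment> \<open>The top group is inhabited, so the bound on the largest
      \<open>(s i)\<^sup>2\<close> limits \<open>2 ^ J\<close>.\<close>
    then obtain i0 where i0: "i0 \<in> {1..k}" "lev i0 = J" by auto
    have "(2 ^ J) ^ 4 = ((2::real) ^ 4) ^ J" by (metis mult.commute power_mult)
    also have "\<dots> = ((4::real) ^ J)\<^sup>2" by (simp add: power2_eq_square flip: power_mult_distrib)
    also have "\<dots> \<le> (s i0)\<^sup>2" using lev(1)[of i0] i0 by (intro power_mono) auto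
    also have "\<dots> \<le> (\<epsilon> * q) ^ 4" using elim(1) i0 q by (auto simp: power_mult_distrib)
    finally have J: "2 ^ J \<le> \<epsilon> * q"
      using \<epsilon> q by (subst (asm) power_mono_iff) auto
    have small: "prob (E j) \<le> 2 ^ j / q" if "j \<le> J" for j
    proof -
      define r where "r = q / 2 ^ j"
      have r: "0 < r" "r ^ 4 = real k / 16 ^ j"
      proof -
        have "((2::real) ^ j) ^ 4 = (2 ^ 4) ^ j" by (metis mult.commute power_mult)
        then show "0 < r" "r ^ 4 = real k / 16 ^ j"
          using q by (simp_all add: r_def power_divide)
      qed
      have "2 ^ j \<le> (2::real) ^ J" using that by (intro power_increasing) auto
      then have "2 ^ j \<le> \<epsilon> * q" using J by linarith
      also have "\<dots> \<le> 1 / max r0 1 * q" using \<epsilon> q by (intro mult_right_mono) auto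
      finally have "max r0 1 * 2 ^ j \<le> q" by (simp add: field_simps)
      moreover have "r0 * 2 ^ j \<le> max r0 1 * 2 ^ j" by (intro mult_right_mono) auto
      ultimately have "r0 * 2 ^ j \<le> q" by linarith
      then have "r0 \<le> r" by (simp add: r_def field_simps)
      have sumG: "(\<Sum>i\<in>G j. (s i)\<^sup>2) \<le> C * real k"
        using sum_mono2[of "{1..k}" "G j" "\<lambda>i. (s i)\<^sup>2"] G elim(2) by auto
      have s_low: "16 ^ j \<le> (s i)\<^sup>2" and s_up: "(s i)\<^sup>2 \<le> 16 * 16 ^ j" if "i \<in> G j" for i
      proof -
        have *: "((4::real) ^ n)\<^sup>2 = 16 ^ n" for n
          by (simp add: power2_eq_square flip: power_mult_distrib)
        show "16 ^ j \<le> (s i)\<^sup>2"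
          using power_mono[OF lev(1)[of i], of 2] that unfolding * by (simp add: G_def)
        have "(s i)\<^sup>2 \<le> (4 ^ (j + 1))\<^sup>2"
          using lev(2)[of i] s[of i] that by (intro power_mono) (auto simp: G_def)
        then show "(s i)\<^sup>2 \<le> 16 * 16 ^ j" unfolding * by simp
      qed
      \<comment> \<open>Each row of the group contributes at least \<open>16 ^ j\<close> to a sum
        bounded by \<open>C * k\<close>, which limits the size of the group.\<close>
      have "real (card (G j)) * 16 ^ j = (\<Sum>i\<in>G j. 16 ^ j)" by simp
      also have "\<dots> \<le> (\<Sum>i\<in>G j. (s i)\<^sup>2)" by (intro sum_mono s_low)
      finally have "real (card (G j)) * 16 ^ j \<le> C * real k" using sumG by linarith
      then have card: "real (card (G j)) \<le> C * r ^ 4"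
        unfolding r by (simp add: field_simps)
      have "(\<Sum>i\<in>G j. (K * s i) ^ 4) = K ^ 4 * (\<Sum>i\<in>G j. (s i)\<^sup>2 * (s i)\<^sup>2)"
        by (simp add: power_mult_distrib sum_distrib_left flip: power_add)
      also have "\<dots> \<le> K ^ 4 * (\<Sum>i\<in>G j. 16 * 16 ^ j * (s i)\<^sup>2)"
        using K s_up by (intro mult_left_mono sum_mono mult_right_mono) auto
      also have "\<dots> = K ^ 4 * (16 * 16 ^ j) * (\<Sum>i\<in>G j. (s i)\<^sup>2)"
        by (simp add: sum_distrib_left mult_ac)
      also have "\<dots> \<le> K ^ 4 * (16 * 16 ^ j) * (C * real k)"
        using K sumG by (intro mult_left_mono) auto
      finally have V: "(\<Sum>i\<in>G j. (K * s i) ^ 4) \<le> K ^ 4 * (16 * 16 ^ j) * (C * real k)" .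
      have pos: "0 < K * s i" for i using K s[of i] by simp
      have "prob (E j) \<le> real (card (range (\<lambda>b. restrict (\<lambda>i. v i b) (G j))))
          * exp (- 2 * (dev j)\<^sup>2 / (K ^ 4 * (16 * 16 ^ j) * (C * real k)))"
        unfolding E_def
      proof (rule square_deviation_union_bound[OF G(1) _ _ _ fin[OF G(1,2)] pos V])
        show "indep_vars (\<lambda>_. borel) Y (G j)" by (rule indep_vars_subset[OF indep G(2)])
        show "0 \<le> dev j" using q by (simp add: dev_def)
      qed (use Y v G(2)[of j] in \<open>auto simp: subset_eq\<close>)
      also have "- 2 * (dev j)\<^sup>2 / (K ^ 4 * (16 * 16 ^ j) * (C * real k)) = - (r\<^sup>2 / (8 * C * K ^ 4))"
      proof -
        have k: "real k = r ^ 4 * 16 ^ j" using r by simp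
        have "dev j = real k / r" by (simp add: dev_def r_def)
        then have "(dev j)\<^sup>2 = real k * (r\<^sup>2 * 16 ^ j)"
          using r(1) k by (simp add: power_divide power2_eq_square power4_eq_xxxx)
        then show ?thesis using r(1) C K elim(3) by (simp add: field_simps)
      qed
      also have "real (card (range (\<lambda>b. restrict (\<lambda>i. v i b) (G j)))) \<le> (real A * C * r ^ 4 + 1) ^ p"
      proof -
        have "real (card (range (\<lambda>b. restrict (\<lambda>i. v i b) (G j)))) \<le> real ((A * card (G j) + 1) ^ p)"
          using growth[OF G(1,2)] of_nat_le_iff by blast
        also have "\<dots> = (real A * real (card (G j)) + 1) ^ p" by (simp add: add.commute)
        also have "\<dots> \<le> (real A * (C * r ^ 4) + 1) ^ p"
          using card by (intro power_mono add_right_mono mult_left_mono) auto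
        finally show ?thesis by (simp add: mult.assoc)
      qed
      also have "(real A * C * r ^ 4 + 1) ^ p * exp (- (r\<^sup>2 / (8 * C * K ^ 4))) \<le> 1 / r"
        by (rule r0) fact
      finally show ?thesis by (simp add: r_def)
    qed
    have geom: "(\<Sum>j\<le>J. 2 ^ j / q) \<le> 2 * \<epsilon>"
    proof -
      have "(\<Sum>j\<le>J. 2 ^ j / q) = (\<Sum>j\<le>J. 2 ^ j) / q" by (rule sum_divide_distrib[symmetric])
      also have "(\<Sum>j\<le>J. (2::real) ^ j) = 2 ^ Suc J - 1"
        using sum_gp_multiplied[of 0 J "2::real"] by (simp add: atMost_atLeast0)
      also have "(2 ^ Suc J - 1) / q \<le> 2 * (2 ^ J) / q" using q by (intro divide_right_mono) auto
      also have "\<dots> \<le> 2 * \<epsilon>" using J q by (simp add: field_simps)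
      finally show ?thesis .
    qed
    have split: "(\<Sum>i\<in>{1..k}. f i) = (\<Sum>j\<le>J. \<Sum>i\<in>G j. f i)" for f :: "nat \<Rightarrow> real"
      unfolding G_def by (rule sum.group[symmetric]) (auto simp: J_def)
    have "{\<omega>\<in>space M. \<exists>b. (\<Sum>i\<in>{1..k}. (Y i \<omega> - v i b)\<^sup>2)
            < (\<Sum>i\<in>{1..k}. expectation (\<lambda>\<omega>. (Y i \<omega> - v i b)\<^sup>2)) - \<eta> * real k} \<subseteq> (\<Union>j\<le>J. E j)"
    \<comment> \<open>If no group falls short by more than its own allowance, adding the group
      inequalities contradicts the total shortfall.\<close>
    proof (rule subsetI, rule ccontr)
      fix \<omega> assume "\<omega> \<in> {\<omega>\<in>space M. \<exists>b. (\<Sum>i\<in>{1..k}. (Y i \<omega> - v i b)\<^sup>2)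
            < (\<Sum>i\<in>{1..k}. expectation (\<lambda>\<omega>. (Y i \<omega> - v i b)\<^sup>2)) - \<eta> * real k}"
      then obtain b where \<omega>: "\<omega> \<in> space M" and b: "(\<Sum>i\<in>{1..k}. (Y i \<omega> - v i b)\<^sup>2)
            < (\<Sum>i\<in>{1..k}. expectation (\<lambda>\<omega>. (Y i \<omega> - v i b)\<^sup>2)) - \<eta> * real k" by auto
      assume "\<omega> \<notin> (\<Union>j\<le>J. E j)"
      have "(\<Sum>i\<in>G j. expectation (\<lambda>\<omega>. (Y i \<omega> - v i b)\<^sup>2)) - dev j
          \<le> (\<Sum>i\<in>G j. (Y i \<omega> - v i b)\<^sup>2)" if "j \<le> J" for j
      proof -
        have "\<omega> \<notin> E j" using \<open>\<omega> \<notin> (\<Union>j\<le>J. E j)\<close> that by auto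
        then show ?thesis unfolding E_def mem_Collect_eq not_ex not_less de_Morgan_conj using \<omega> by blast
      qed
      then have "(\<Sum>j\<le>J. (\<Sum>i\<in>G j. expectation (\<lambda>\<omega>. (Y i \<omega> - v i b)\<^sup>2)) - dev j)
          \<le> (\<Sum>j\<le>J. \<Sum>i\<in>G j. (Y i \<omega> - v i b)\<^sup>2)" by (intro sum_mono) auto
      then have "(\<Sum>i\<in>{1..k}. expectation (\<lambda>\<omega>. (Y i \<omega> - v i b)\<^sup>2)) - (\<Sum>j\<le>J. dev j)
          \<le> (\<Sum>i\<in>{1..k}. (Y i \<omega> - v i b)\<^sup>2)"
        unfolding split by (simp add: sum_subtractf)
      moreover have "(\<Sum>j\<le>J. dev j) = real k * (\<Sum>j\<le>J. 2 ^ j / q)"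
        by (simp add: dev_def sum_distrib_left)
      moreover have "\<dots> \<le> real k * \<eta>" using geom \<epsilon> by (intro mult_left_mono) auto
      ultimately show False using b by (simp add: mult.commute)
    qed
    then have "?P k \<le> prob (\<Union>j\<le>J. E j)"
      by (rule finite_measure_mono) (use E_ev in auto)
    also have "\<dots> \<le> (\<Sum>j\<le>J. prob (E j))"
      by (rule finite_measure_subadditive_finite) (use E_ev in auto)
    also have "\<dots> \<le> (\<Sum>j\<le>J. 2 ^ j / q)" by (intro sum_mono small) auto
    also have "\<dots> < e" using geom \<epsilon> by linarith
    finally show ?case by (simp add: measure_nonneg)
  qed
qed

end

section \<open>Mixed Poisson counts\<close>

locale mixing_distribution = prob_space D for D :: "real measure" +
  assumes sets_mixing [measurable_cong]: "sets D = sets borel"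
    and mixing_nonneg: "AE th in D. 0 \<le> th"
    and mixing_square_integrable: "integrable D (\<lambda>th. th\<^sup>2)"
    and mixing_mean: "(\<integral>th. th \<partial>D) = 1"
begin

lemma mixing_integrable: "integrable D (\<lambda>th. th)"
  by (rule square_integrable_imp_integrable) (auto simp: mixing_square_integrable)

text \<open>
  Given the rate \<open>th * l\<close>, the second moment of a Poisson count \<open>N\<close> and its third moment divided by
  \<open>K s\<close> both bound the mean of \<open>N\<^sup>2\<close> on \<open>N > K s\<close>; for \<open>s \<ge> 1, l\<close> each is at most \<open>s\<^sup>2\<close> times an
  argument of the minimum.
\<close>
definition tail_bound :: "real \<Rightarrow> real" where
  "tail_bound K = (\<integral>th. min (th\<^sup>2 + th) ((th ^ 3 + 3 * th\<^sup>2 + th) / K) \<partial>D)"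

lemma tail_bound_integrable:
  assumes "0 \<le> K"
  shows "integrable D (\<lambda>th. min (th\<^sup>2 + th) ((th ^ 3 + 3 * th\<^sup>2 + th) / K))"
proof (rule Bochner_Integration.integrable_bound)
  show "integrable D (\<lambda>th. th\<^sup>2 + th)"
    by (intro Bochner_Integration.integrable_add mixing_square_integrable mixing_integrable)
  show "AE th in D. norm (min (th\<^sup>2 + th) ((th ^ 3 + 3 * th\<^sup>2 + th) / K)) \<le> norm (th\<^sup>2 + th)"
    using mixing_nonneg 
  proof eventually_elim
    case (elim th)
    then have "0 \<le> th\<^sup>2 + th" "0 \<le> (th ^ 3 + 3 * th\<^sup>2 + th) / K" using assms by auto
    then show ?case by auto
  qed
qed measurable

lemma tail_bound_nonneg:
  assumes "0 \<le> K"
  shows "0 \<le> tail_bound K"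
  unfolding tail_bound_def
proof (rule integral_nonneg_AE)
  show "AE th in D. 0 \<le> min (th\<^sup>2 + th) ((th ^ 3 + 3 * th\<^sup>2 + th) / K)"
    using mixing_nonneg by eventually_elim (use assms in auto)
qed

text \<open>Dominated convergence: the first argument of the minimum is integrable by the second
  moment of \<open>D\<close>, and the second tends to zero pointwise. No third moment of
  \<open>D\<close> enters.\<close>

lemma tail_bound_tendsto_0: "(\<lambda>n. tail_bound (real n)) \<longlonglongrightarrow> 0"
proof -
  have "(\<lambda>n. tail_bound (real n)) \<longlonglongrightarrow> (\<integral>th. 0 \<partial>D)"
    unfolding tail_bound_def
  proof (rule integral_dominated_convergence[where w = "\<lambda>th. th\<^sup>2 + th"])
    show "integrable D (\<lambda>th. th\<^sup>2 + th)"
      by (intro Bochner_Integration.integrable_add mixing_square_integrable mixing_integrable)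
    show "AE th in D. (\<lambda>n. min (th\<^sup>2 + th) ((th ^ 3 + 3 * th\<^sup>2 + th) / real n)) \<longlonglongrightarrow> 0"
      using mixing_nonneg
    proof eventually_elim
      case (elim th)
      have "(\<lambda>n. (th ^ 3 + 3 * th\<^sup>2 + th) / real n) \<longlonglongrightarrow> 0"
        by (rule lim_const_over_n)
      then have "(\<lambda>n. min (th\<^sup>2 + th) ((th ^ 3 + 3 * th\<^sup>2 + th) / real n)) \<longlonglongrightarrow> min (th\<^sup>2 + th) 0"
        by (intro tendsto_min tendsto_const)
      then show ?case using elim by simp
    qed
    show "AE th in D. norm (min (th\<^sup>2 + th) ((th ^ 3 + 3 * th\<^sup>2 + th) / real n)) \<le> th\<^sup>2 + th" for n
      using mixing_nonneg
    proof eventually_elim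
      case (elim th)
      then have "0 \<le> th\<^sup>2 + th" "0 \<le> (th ^ 3 + 3 * th\<^sup>2 + th) / real n" by auto
      then show ?case by auto
    qed
  qed measurable
  then show ?thesis by simp
qed

end

section \<open>Moments and tails of a single mixed Poisson count\<close>

locale mixed_poisson = mixing_distribution D + M: prob_space M
  for D :: "real measure" and M :: "'a measure" +
  fixes N :: "'a \<Rightarrow> nat" and l :: real
  assumes count_measurable [measurable]: "N \<in> measurable M (count_space UNIV)"
    and rate_pos: "0 < l"
    and count_law: "\<And>n. measure M {\<omega> \<in> space M. N \<omega> = n} = (\<integral>th. pois_pmf (th * l) n \<partial>D)"
begin

lemma pois_pmf_measurable [measurable]: "(\<lambda>th. pois_pmf (th * l) n) \<in> borel_measurable borel"
  unfolding pois_pmf_def by measurable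

text \<open>Sums and integrals of nonnegative terms may be exchanged before anything is known to be
  integrable.\<close>

lemma nn_integral_count:
  fixes g :: "nat \<Rightarrow> real"
  assumes g: "\<And>n. 0 \<le> g n"
  shows "(\<integral>\<^sup>+\<omega>. ennreal (g (N \<omega>)) \<partial>M) = (\<integral>\<^sup>+th. (\<Sum>n. ennreal (pois_pmf (th * l) n * g n)) \<partial>D)"
proof -
  have pmf: "emeasure M {\<omega> \<in> space M. N \<omega> = n} = (\<integral>\<^sup>+th. ennreal (pois_pmf (th * l) n) \<partial>D)" for n
  proof -
    have nonneg: "AE th in D. 0 \<le> pois_pmf (th * l) n"
      using mixing_nonneg by eventually_elim (use rate_pos in \<open>auto intro: pois_pmf_nonneg\<close>)
    have "AE th in D. norm (pois_pmf (th * l) n) \<le> 1"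
      using mixing_nonneg
    proof eventually_elim
      case (elim th)
      then have r: "0 \<le> th * l" using rate_pos by simp
      have "(\<Sum>i\<in>{n}. pois_pmf (th * l) i) \<le> (\<Sum>i. pois_pmf (th * l) i)"
        using pois_pmf_nonneg[OF r] by (intro sum_le_suminf sums_summable[OF pois_pmf_sums]) auto
      then show ?case using pois_pmf_nonneg[OF r] sums_unique[OF pois_pmf_sums] by simp
    qed
    then have "integrable D (\<lambda>th. pois_pmf (th * l) n)"
      by (intro integrable_const_bound) measurable
    then show ?thesis
      using nonneg by (simp add: M.emeasure_eq_measure count_law nn_integral_eq_integral)
  qed
  have "(\<integral>\<^sup>+\<omega>. ennreal (g (N \<omega>)) \<partial>M)
      = (\<integral>\<^sup>+\<omega>. (\<Sum>n. ennreal (g n) * indicator {\<omega> \<in> space M. N \<omega> = n} \<omega>) \<partial>M)"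
  proof (intro nn_integral_cong)
    fix \<omega> assume "\<omega> \<in> space M"
    then show "ennreal (g (N \<omega>)) = (\<Sum>n. ennreal (g n) * indicator {\<omega> \<in> space M. N \<omega> = n} \<omega>)"
      by (subst suminf_finite[of "{N \<omega>}"]) auto
  qed
  also have "\<dots> = (\<Sum>n. ennreal (g n) * emeasure M {\<omega> \<in> space M. N \<omega> = n})"
    by (subst nn_integral_suminf) (auto simp: nn_integral_cmult_indicator)
  also have "\<dots> = (\<Sum>n. (\<integral>\<^sup>+th. ennreal (g n) * ennreal (pois_pmf (th * l) n) \<partial>D))"
    by (simp add: pmf nn_integral_cmult)
  also have "\<dots> = (\<integral>\<^sup>+th. (\<Sum>n. ennreal (g n) * ennreal (pois_pmf (th * l) n)) \<partial>D)"
    by (subst nn_integral_suminf) auto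
  also have "\<dots> = (\<integral>\<^sup>+th. (\<Sum>n. ennreal (pois_pmf (th * l) n * g n)) \<partial>D)"
    by (intro nn_integral_cong suminf_cong) (simp add: g mult.commute[of "pois_pmf _ _"] ennreal_mult')
  finally show ?thesis .
qed

text \<open>Here \<open>h r\<close> is the mean of \<open>g\<close> under the Poisson law of rate
  \<open>r\<close>, and the lemma averages this conditional mean over the mixing law. Integrability
  over \<open>M\<close> is a consequence of that over \<open>D\<close>.\<close>

lemma count_expectation:
  fixes g :: "nat \<Rightarrow> real" and h :: "real \<Rightarrow> real"
  assumes g: "\<And>n. 0 \<le> g n"
    and sums: "\<And>r. 0 \<le> r \<Longrightarrow> (\<lambda>n. pois_pmf r n * g n) sums h r"
    and int: "integrable D (\<lambda>th. h (th * l))"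
  shows "integrable M (\<lambda>\<omega>. g (N \<omega>))"
    and "(\<integral>\<omega>. g (N \<omega>) \<partial>M) = (\<integral>th. h (th * l) \<partial>D)"
proof -
  have h_nonneg: "0 \<le> h r" if "0 \<le> r" for r
    using sums_le[OF _ sums_zero sums[OF that]] g pois_pmf_nonneg[OF that] by auto
  have h_AE_nonneg: "AE th in D. 0 \<le> h (th * l)"
    using mixing_nonneg by eventually_elim (use rate_pos in \<open>auto intro: h_nonneg\<close>)
  have "(\<integral>\<^sup>+\<omega>. ennreal (g (N \<omega>)) \<partial>M) = (\<integral>\<^sup>+th. ennreal (h (th * l)) \<partial>D)"
    unfolding nn_integral_count[of g, OF g]
  proof (rule nn_integral_cong_AE)
    show "AE th in D. (\<Sum>n. ennreal (pois_pmf (th * l) n * g n)) = ennreal (h (th * l))"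
      using mixing_nonneg
      by eventually_elim
         (use g rate_pos in \<open>auto intro!: suminf_ennreal_eq sums mult_nonneg_nonneg pois_pmf_nonneg\<close>)
  qed
  also have "\<dots> = ennreal (\<integral>th. h (th * l) \<partial>D)"
    by (rule nn_integral_eq_integral[OF int h_AE_nonneg])
  finally have *: "(\<integral>\<^sup>+\<omega>. ennreal (g (N \<omega>)) \<partial>M) = ennreal (\<integral>th. h (th * l) \<partial>D)" .
  have nn: "0 \<le> (\<integral>th. h (th * l) \<partial>D)"
    using h_AE_nonneg by (rule integral_nonneg_AE)
  show "integrable M (\<lambda>\<omega>. g (N \<omega>))"
    by (rule integrableI_nn_integral_finite[OF _ _ *]) (auto simp: g)
  show "(\<integral>\<omega>. g (N \<omega>) \<partial>M) = (\<integral>th. h (th * l) \<partial>D)"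
    by (rule integral_eq_nn_integral[THEN trans]) (auto simp: g * nn)
qed

lemma count_mean: "(\<integral>\<omega>. real (N \<omega>) \<partial>M) = l"
  using count_expectation(2)[of real "\<lambda>r. r"] pois_pmf_first_moment mixing_integrable mixing_mean
  by simp

lemma count_square_integrable: "integrable M (\<lambda>\<omega>. (real (N \<omega>))\<^sup>2)"
  and count_second_moment:
    "(\<integral>\<omega>. (real (N \<omega>))\<^sup>2 \<partial>M) = l + l\<^sup>2 * (\<integral>th. th\<^sup>2 \<partial>D)"
proof -
  have int: "integrable D (\<lambda>th. (th * l)\<^sup>2 + th * l)"
    unfolding power_mult_distrib
    by (intro Bochner_Integration.integrable_add integrable_mult_left mixing_square_integrable
        mixing_integrable)
  show "integrable M (\<lambda>\<omega>. (real (N \<omega>))\<^sup>2)"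
    by (rule count_expectation(1)[where h = "\<lambda>r. r\<^sup>2 + r"])
       (use pois_pmf_second_moment int in auto)
  have "(\<integral>\<omega>. (real (N \<omega>))\<^sup>2 \<partial>M) = (\<integral>th. (th * l)\<^sup>2 + th * l \<partial>D)"
    by (rule count_expectation(2)[where h = "\<lambda>r. r\<^sup>2 + r"])
       (use pois_pmf_second_moment int in auto)
  also have "\<dots> = l + l\<^sup>2 * (\<integral>th. th\<^sup>2 \<partial>D)"
    using mixing_square_integrable mixing_integrable mixing_mean by (simp add: power_mult_distrib)
  finally show "(\<integral>\<omega>. (real (N \<omega>))\<^sup>2 \<partial>M) = l + l\<^sup>2 * (\<integral>th. th\<^sup>2 \<partial>D)" .
qed

text \<open>This is the law of total variance: \<open>l\<close> is the mean of the conditional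
  variance, and the other term, the overdispersion that the test detects, is the variance of the
  conditional mean.\<close>

lemma count_variance:
  "(\<integral>\<omega>. (real (N \<omega>) - l)\<^sup>2 \<partial>M) = l + l\<^sup>2 * (\<integral>th. (th - 1)\<^sup>2 \<partial>D)"
proof -
  have "integrable M (\<lambda>\<omega>. real (N \<omega>))"
    by (rule M.square_integrable_imp_integrable) (auto simp: count_square_integrable)
  then have "(\<integral>\<omega>. (real (N \<omega>) - l)\<^sup>2 \<partial>M) = (\<integral>\<omega>. (real (N \<omega>))\<^sup>2 \<partial>M) - l\<^sup>2"
    using M.variance_eq[of "\<lambda>\<omega>. real (N \<omega>)"] count_square_integrable by (simp add: count_mean)
  moreover have "(\<integral>th. (th - 1)\<^sup>2 \<partial>D) = (\<integral>th. th\<^sup>2 \<partial>D) - 1"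
    using variance_eq[of "\<lambda>th. th"] mixing_integrable mixing_square_integrable
    by (simp add: mixing_mean)
  ultimately show ?thesis unfolding count_second_moment by (simp add: right_diff_distrib)
qed

text \<open>A uniform integrability bound: the rate enters only through the factor
  \<open>s\<^sup>2\<close>, so one truncation constant \<open>K\<close> serves all counts. It is
  proved inside the integral over \<open>th\<close>, where the two Poisson moment bounds hold for
  each rate \<open>th * l \<le> th * s\<close>.\<close>

lemma count_tail:
  assumes s: "1 \<le> s" "l \<le> s" and K: "0 < K"
  shows "(\<integral>\<omega>. (if K * s < real (N \<omega>) then (real (N \<omega>))\<^sup>2 else 0) \<partial>M) \<le> s\<^sup>2 * tail_bound K"
proof -
  define g where "g = (\<lambda>n. if K * s < real n then (real n)\<^sup>2 else 0)"
  let ?m = "\<lambda>th. min (th\<^sup>2 + th) ((th ^ 3 + 3 * th\<^sup>2 + th) / K)"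
  have g: "0 \<le> g n" for n by (simp add: g_def)
  have Ks: "0 < K * s" using s K by simp
  have "(\<integral>\<^sup>+\<omega>. ennreal (g (N \<omega>)) \<partial>M) \<le> (\<integral>\<^sup>+th. ennreal (s\<^sup>2 * ?m th) \<partial>D)"
    unfolding nn_integral_count[of g, OF g]
  proof (rule nn_integral_mono_AE)
    show "AE th in D. (\<Sum>n. ennreal (pois_pmf (th * l) n * g n)) \<le> ennreal (s\<^sup>2 * ?m th)"
      using mixing_nonneg
    proof eventually_elim
      case (elim th)
      let ?r = "th * l"
      have r: "0 \<le> ?r" "?r \<le> th * s" using elim rate_pos s by (auto intro: mult_left_mono)
      note p = pois_pmf_nonneg[OF r(1)]
      have s2: "s \<le> s\<^sup>2" "s\<^sup>2 \<le> s ^ 3" "s \<le> s ^ 3"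
        using s power_increasing[of 1 2 s] power_increasing[of 2 3 s] power_increasing[of 1 3 s]
        by auto
      have r2: "?r\<^sup>2 \<le> s\<^sup>2 * th\<^sup>2" and r3: "?r ^ 3 \<le> s ^ 3 * th ^ 3"
        using power_mono[OF r(2,1), of 2] power_mono[OF r(2,1), of 3]
        by (auto simp: power_mult_distrib mult.commute)
      have r1: "?r \<le> s\<^sup>2 * th"
        using r(2) mult_left_mono[OF s2(1) elim] by (simp add: mult.commute)
      have "(\<Sum>n. ennreal (pois_pmf ?r n * g n)) \<le> (\<Sum>n. ennreal (pois_pmf ?r n * (real n)\<^sup>2))"
        by (intro suminf_le ennreal_leI mult_left_mono p) (auto simp: g_def)
      also have "\<dots> = ennreal (?r\<^sup>2 + ?r)"
        by (intro suminf_ennreal_eq pois_pmf_second_moment) (auto simp: p)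
      also have "\<dots> \<le> ennreal (s\<^sup>2 * (th\<^sup>2 + th))"
        using r1 r2 by (intro ennreal_leI) (simp add: algebra_simps)
      finally have 1: "(\<Sum>n. ennreal (pois_pmf ?r n * g n)) \<le> ennreal (s\<^sup>2 * (th\<^sup>2 + th))" .
      have gn: "g n \<le> real n ^ 3 / (K * s)" for n
      proof (cases "K * s < real n")
        case True
        then have "(real n)\<^sup>2 * (K * s) \<le> (real n)\<^sup>2 * real n" by (intro mult_left_mono) auto
        then show ?thesis using True Ks by (simp add: g_def pos_le_divide_eq power3_eq_cube power2_eq_square)
      next
        case False
        then show ?thesis using Ks by (simp add: g_def)
      qed
      have "(\<Sum>n. ennreal (pois_pmf ?r n * g n))
          \<le> (\<Sum>n. ennreal (pois_pmf ?r n * real n ^ 3 / (K * s)))"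
        using gn mult_left_mono[OF gn p] by (intro suminf_le ennreal_leI) auto
      also have "\<dots> = ennreal ((?r ^ 3 + 3 * ?r\<^sup>2 + ?r) / (K * s))"
        using Ks by (intro suminf_ennreal_eq sums_divide pois_pmf_third_moment) (auto simp: p)
      also have "\<dots> \<le> ennreal (s\<^sup>2 * ((th ^ 3 + 3 * th\<^sup>2 + th) / K))"
      proof (rule ennreal_leI)
        have "?r\<^sup>2 \<le> s ^ 3 * th\<^sup>2"
          using r2 mult_right_mono[OF s2(2), of "th\<^sup>2"] by simp
        moreover have "?r \<le> s ^ 3 * th"
          using r1 mult_right_mono[OF s2(2) elim] by simp
        ultimately have "?r ^ 3 + 3 * ?r\<^sup>2 + ?r \<le> s ^ 3 * (th ^ 3 + 3 * th\<^sup>2 + th)"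
          using r3 by (simp add: algebra_simps)
        then have "(?r ^ 3 + 3 * ?r\<^sup>2 + ?r) / (K * s) \<le> s ^ 3 * (th ^ 3 + 3 * th\<^sup>2 + th) / (K * s)"
          using Ks by (intro divide_right_mono) auto
        also have "\<dots> = s\<^sup>2 * ((th ^ 3 + 3 * th\<^sup>2 + th) / K)"
          using s K by (simp add: power2_eq_square power3_eq_cube)
        finally show "(?r ^ 3 + 3 * ?r\<^sup>2 + ?r) / (K * s) \<le> s\<^sup>2 * ((th ^ 3 + 3 * th\<^sup>2 + th) / K)" .
      qed
      finally show ?case using 1 by (auto simp: min_def)
    qed
  qed
  also have "\<dots> = ennreal (\<integral>th. s\<^sup>2 * ?m th \<partial>D)"
  proof (rule nn_integral_eq_integral)
    show "integrable D (\<lambda>th. s\<^sup>2 * ?m th)"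
      using K by (intro integrable_mult_right tail_bound_integrable) auto
    show "AE th in D. 0 \<le> s\<^sup>2 * ?m th"
      using mixing_nonneg by eventually_elim (use K in auto)
  qed
  also have "(\<integral>th. s\<^sup>2 * ?m th \<partial>D) = s\<^sup>2 * tail_bound K"
    by (simp add: tail_bound_def)
  finally have "(\<integral>\<^sup>+\<omega>. ennreal (g (N \<omega>)) \<partial>M) \<le> ennreal (s\<^sup>2 * tail_bound K)" .
  moreover have "0 \<le> tail_bound K"
    using K by (intro tail_bound_nonneg) simp
  moreover have "(\<integral>\<omega>. g (N \<omega>) \<partial>M) = enn2real (\<integral>\<^sup>+\<omega>. ennreal (g (N \<omega>)) \<partial>M)"
    by (rule integral_eq_nn_integral) (auto simp: g)
  ultimately have "(\<integral>\<omega>. g (N \<omega>) \<partial>M) \<le> s\<^sup>2 * tail_bound K"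
    by (metis enn2real_leI mult_nonneg_nonneg zero_le_power2)
  then show ?thesis by (simp add: g_def)
qed

end

section \<open>The saturated random effect model\<close>

text \<open>For \<open>1 \<le> l\<close> the condition
  \<open>real l * g i \<le> exp (x i t \<bullet> b)\<close> says
  \<open>ln (real l * g i) \<le> x i t \<bullet> b\<close>, a half-space of parameters. The rounded
  values are thus a function of a half-space pattern over the triples \<open>(i, t, l)\<close>, of
  which there are at most \<open>Tmax * L * card G\<close>.\<close>

lemma card_quantised_rate_patterns:
  fixes x :: "nat \<Rightarrow> nat \<Rightarrow> 'v::euclidean_space" and g :: "nat \<Rightarrow> real" and T :: "nat \<Rightarrow> nat"
    and L :: nat
  assumes G: "finite G" and g: "\<And>i. 0 < g i" and T: "\<And>i. T i \<le> Tmax"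
  defines "v \<equiv> \<lambda>i b. min (\<Sum>t\<in>{1..T i}. g i * real (card {l\<in>{1..L}. real l * g i \<le> exp (x i t \<bullet> b)}))
                        (g i * real L)"
  shows "finite (range (\<lambda>b. restrict (\<lambda>i. v i b) G))"
    and "card (range (\<lambda>b. restrict (\<lambda>i. v i b) G)) \<le> (Tmax * L * card G + 1) ^ DIM('v)"
proof -
  define J where "J = (SIGMA i:G. {1..T i} \<times> {1..L})"
  define pat where "pat = (\<lambda>b. {j\<in>J. (case j of (i, t, l) \<Rightarrow> ln (real l * g i))
      \<le> (case j of (i, t, l) \<Rightarrow> x i t) \<bullet> b})"
  \<comment> \<open>The map that recovers the rounded row values from a pattern.\<close>
  define \<Phi> where "\<Phi> = (\<lambda>P :: (nat \<times> nat \<times> nat) set. \<lambda>i\<in>G. min (\<Sum>t\<in>{1..T i}. g i * real (card {l. (i, t, l) \<in> P})) (g i * real L))"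
  have finJ: "finite J" using G by (auto simp: J_def)
  have "{l. (i, t, l) \<in> pat b} = {l\<in>{1..L}. real l * g i \<le> exp (x i t \<bullet> b)}"
    if "i \<in> G" "t \<in> {1..T i}" for i t b
  proof -
    have "ln (real l * g i) \<le> x i t \<bullet> b \<longleftrightarrow> real l * g i \<le> exp (x i t \<bullet> b)" if "1 \<le> l" for l
    proof -
      have "0 < real l * g i" using that g by simp
      then show ?thesis by (metis exp_le_cancel_iff exp_ln)
    qed
    then show ?thesis using that by (auto simp: pat_def J_def)
  qed
  then have "restrict (\<lambda>i. v i b) G = \<Phi> (pat b)" for b
    by (auto simp: \<Phi>_def v_def fun_eq_iff restrict_def intro!: arg_cong[where f = "\<lambda>y. min y _"] sum.cong)
  then have eq: "range (\<lambda>b. restrict (\<lambda>i. v i b) G) = \<Phi> ` range pat" by auto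
  have fin: "finite (range pat)"
    by (rule finite_subset[of _ "Pow J"]) (auto simp: pat_def finJ)
  show "finite (range (\<lambda>b. restrict (\<lambda>i. v i b) G))" unfolding eq using fin by simp
  have "card J = (\<Sum>i\<in>G. T i * L)" using G by (simp add: J_def card_SigmaI)
  also have "\<dots> \<le> (\<Sum>i\<in>G. Tmax * L)" using T by (intro sum_mono mult_right_mono) auto
  finally have cardJ: "card J \<le> Tmax * L * card G" by (simp add: mult.commute)
  have "card (\<Phi> ` range pat) \<le> card (range pat)" by (rule card_image_le[OF fin])
  also have "\<dots> \<le> (card J + 1) ^ DIM('v)"
    unfolding pat_def by (rule card_halfspace_patterns[OF finJ])
  also have "\<dots> \<le> (Tmax * L * card G + 1) ^ DIM('v)" using cardJ by (intro power_mono) auto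
  finally show "card (range (\<lambda>b. restrict (\<lambda>i. v i b) G)) \<le> (Tmax * L * card G + 1) ^ DIM('v)"
    unfolding eq .
qed

section \<open>Row sums: independence, moments and tails\<close>

locale saturated_model = mixing_distribution D + M: prob_space M
  for D :: "real measure" and M :: "'a measure" +
  fixes T :: "nat \<Rightarrow> nat" and lam :: "nat \<Rightarrow> nat \<Rightarrow> real" and N :: "nat \<Rightarrow> nat \<Rightarrow> 'a \<Rightarrow> nat"
    and Tmax :: nat
  assumes T_le: "\<And>i. T i \<le> Tmax" and Tmax_pos: "1 \<le> Tmax"
    and lam_pos: "\<And>i t. 0 < lam i t"
    and N_indep: "M.indep_vars (\<lambda>_. count_space UNIV) (\<lambda>(i, t). N i t)
        {(i, t). 1 \<le> i \<and> 1 \<le> t \<and> t \<le> T i}"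
    and N_law: "\<And>i t n. 1 \<le> i \<Longrightarrow> 1 \<le> t \<Longrightarrow> t \<le> T i \<Longrightarrow>
        measure M {\<omega> \<in> space M. N i t \<omega> = n} = (\<integral>th. pois_pmf (th * lam i t) n \<partial>D)"
begin

definition S :: "nat \<Rightarrow> 'a \<Rightarrow> real" where
  "S i \<omega> = (\<Sum>t\<in>{1..T i}. real (N i t \<omega>))"

definition Lam :: "nat \<Rightarrow> real" where "Lam i = (\<Sum>t\<in>{1..T i}. lam i t)"

text \<open>The size of row \<open>i\<close>. The added one keeps it at least 1, as grouping by
  logarithms and comparing powers of the size require, while it still dominates every rate in the
  row.\<close>

definition scl :: "nat \<Rightarrow> real" where "scl i = 1 + Lam i"

definition tau2 :: real where "tau2 = (\<integral>th. (th - 1)\<^sup>2 \<partial>D)"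

definition varS :: "nat \<Rightarrow> real" where
  "varS i = Lam i + tau2 * (\<Sum>t\<in>{1..T i}. (lam i t)\<^sup>2)"

lemma tau2_nonneg: "0 \<le> tau2"
  unfolding tau2_def by (rule integral_nonneg_AE) simp

lemma mixed_poisson:
  assumes "1 \<le> i" "t \<in> {1..T i}"
  shows "mixed_poisson D M (N i t) (lam i t)"
proof unfold_locales
  have "(i, t) \<in> {(i, t). 1 \<le> i \<and> 1 \<le> t \<and> t \<le> T i}" using assms by simp
  then have "(case (i, t) of (i, t) \<Rightarrow> N i t) \<in> measurable M (count_space UNIV)"
    using N_indep unfolding M.indep_vars_def by blast
  then show "N i t \<in> measurable M (count_space UNIV)" by simp
qed (use assms lam_pos N_law in auto)

lemma real_N_rv:
  assumes "1 \<le> i" "t \<in> {1..T i}"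
  shows "M.random_variable borel (\<lambda>\<omega>. real (N i t \<omega>))"
  using mixed_poisson.count_measurable[OF mixed_poisson[OF assms]] by simp

lemma real_N_indep:
  "M.indep_vars (\<lambda>_. borel) (\<lambda>(i, t) \<omega>. real (N i t \<omega>)) {(i, t). 1 \<le> i \<and> 1 \<le> t \<and> t \<le> T i}"
proof -
  have "M.indep_vars (\<lambda>_. borel) (\<lambda>p \<omega>. real ((case p of (i, t) \<Rightarrow> N i t) \<omega>))
      {(i, t). 1 \<le> i \<and> 1 \<le> t \<and> t \<le> T i}"
    by (rule M.indep_vars_compose2[OF N_indep]) auto
  then show ?thesis by (simp add: case_prod_beta')
qed

lemma S_rv: "1 \<le> i \<Longrightarrow> M.random_variable borel (S i)"
  unfolding S_def by (intro borel_measurable_sum real_N_rv) auto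

text \<open>Row sums are functions of disjoint blocks of the independent counts.\<close>

lemma S_indep: "M.indep_vars (\<lambda>_. borel) S {1..}"
proof -
  define B where "B = (\<lambda>i. {i} \<times> {1..T i})"
  have "M.indep_vars (\<lambda>i. PiM (B i) (\<lambda>_. borel))
      (\<lambda>i \<omega>. restrict (\<lambda>p. (\<lambda>(i, t) \<omega>. real (N i t \<omega>)) p \<omega>) (B i)) {1..}"
    by (rule M.indep_vars_restrict[OF real_N_indep]) (auto simp: B_def disjoint_family_on_def)
  then have "M.indep_vars (\<lambda>_. borel)
      (\<lambda>i \<omega>. (\<lambda>f. \<Sum>p\<in>B i. f p) (restrict (\<lambda>p. (\<lambda>(i, t) \<omega>. real (N i t \<omega>)) p \<omega>) (B i))) {1..}"
    by (rule M.indep_vars_compose2) (auto intro!: borel_measurable_sum measurable_component_singleton)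
  also have "(\<lambda>i \<omega>. (\<lambda>f. \<Sum>p\<in>B i. f p) (restrict (\<lambda>p. (\<lambda>(i, t) \<omega>. real (N i t \<omega>)) p \<omega>) (B i))) = S"
  proof (intro ext)
    fix i \<omega>
    have "(\<Sum>p\<in>B i. restrict (\<lambda>p. (\<lambda>(i, t) \<omega>. real (N i t \<omega>)) p \<omega>) (B i) p)
        = (\<Sum>p\<in>Pair i ` {1..T i}. real (N (fst p) (snd p) \<omega>))"
      by (rule sum.cong) (auto simp: B_def)
    also have "\<dots> = S i \<omega>" by (subst sum.reindex) (auto simp: S_def inj_on_def)
    finally show "(\<Sum>p\<in>B i. restrict (\<lambda>p. (\<lambda>(i, t) \<omega>. real (N i t \<omega>)) p \<omega>) (B i) p) = S i \<omega>" .
  qed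
  finally show ?thesis .
qed

lemma Lam_nonneg: "0 \<le> Lam i"
  unfolding Lam_def using lam_pos by (intro sum_nonneg) (auto simp: less_imp_le)

lemma scl_ge_1: "1 \<le> scl i" using Lam_nonneg by (simp add: scl_def)

lemma lam_le_scl: "t \<in> {1..T i} \<Longrightarrow> lam i t \<le> scl i"
  unfolding scl_def Lam_def
  using member_le_sum[of t "{1..T i}" "lam i"] lam_pos by (auto simp: less_imp_le)

lemma S_nonneg: "0 \<le> S i \<omega>" by (simp add: S_def sum_nonneg)

text \<open>In the saturated model the counts within a row are independent too, so their variances
  add.\<close>

lemma S_moments:
  assumes i: "1 \<le> i"
  shows "integrable M (\<lambda>\<omega>. (S i \<omega>)\<^sup>2)" "integrable M (S i)" "M.expectation (S i) = Lam i"
    and "M.expectation (\<lambda>\<omega>. (S i \<omega> - Lam i)\<^sup>2) = varS i"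
proof -
  have mp: "mixed_poisson D M (N i t) (lam i t)" if "t \<in> {1..T i}" for t
    by (rule mixed_poisson[OF i that])
  have indep: "M.indep_vars (\<lambda>_. borel) (\<lambda>t \<omega>. real (N i t \<omega>)) {1..T i}"
  proof -
    have "M.indep_vars (\<lambda>t. PiM {(i, t)} (\<lambda>_. borel))
        (\<lambda>t \<omega>. restrict (\<lambda>p. (\<lambda>(i, t) \<omega>. real (N i t \<omega>)) p \<omega>) {(i, t)}) {1..T i}"
      by (rule M.indep_vars_restrict[OF real_N_indep]) (use i in \<open>auto simp: disjoint_family_on_def\<close>)
    then have "M.indep_vars (\<lambda>_. borel) (\<lambda>t \<omega>. (\<lambda>f. f (i, t))
        (restrict (\<lambda>p. (\<lambda>(i, t) \<omega>. real (N i t \<omega>)) p \<omega>) {(i, t)})) {1..T i}"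
      by (rule M.indep_vars_compose2) (auto intro!: measurable_component_singleton)
    then show ?thesis by simp
  qed
  have sq: "integrable M (\<lambda>\<omega>. (real (N i t \<omega>))\<^sup>2)" if "t \<in> {1..T i}" for t
    by (rule mixed_poisson.count_square_integrable[OF mp[OF that]])
  have mean: "M.expectation (\<lambda>\<omega>. real (N i t \<omega>)) = lam i t" if "t \<in> {1..T i}" for t
    by (rule mixed_poisson.count_mean[OF mp[OF that]])
  have int: "integrable M (\<lambda>\<omega>. real (N i t \<omega>))" if "t \<in> {1..T i}" for t
    by (rule M.square_integrable_imp_integrable[OF real_N_rv[OF i that] sq[OF that]])
  show "integrable M (\<lambda>\<omega>. (S i \<omega>)\<^sup>2)"
    unfolding S_def by (rule M.variance_sum_indep(1)[OF _ indep sq mean]) auto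
  show "integrable M (S i)" unfolding S_def using int by auto
  show "M.expectation (S i) = Lam i" unfolding S_def Lam_def using int mean by simp
  have "M.expectation (\<lambda>\<omega>. (S i \<omega> - Lam i)\<^sup>2)
      = (\<Sum>t\<in>{1..T i}. M.expectation (\<lambda>\<omega>. (real (N i t \<omega>) - lam i t)\<^sup>2))"
    unfolding S_def Lam_def by (rule M.variance_sum_indep(2)[OF _ indep sq mean]) auto
  also have "\<dots> = (\<Sum>t\<in>{1..T i}. lam i t + (lam i t)\<^sup>2 * tau2)"
    by (intro sum.cong refl) (simp add: mixed_poisson.count_variance[OF mp] tau2_def)
  also have "\<dots> = varS i"
    by (simp add: varS_def Lam_def sum.distrib sum_distrib_left mult.commute)
  finally show "M.expectation (\<lambda>\<omega>. (S i \<omega> - Lam i)\<^sup>2) = varS i" .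
qed

text \<open>The decomposition into variance and squared bias; the instance \<open>w = Lam i\<close>
  expresses the second moment through \<open>varS i\<close>.\<close>

lemma expectation_square_diff:
  assumes "1 \<le> i"
  shows "integrable M (\<lambda>\<omega>. (S i \<omega> - w)\<^sup>2)"
    and "M.expectation (\<lambda>\<omega>. (S i \<omega> - w)\<^sup>2) = varS i + (Lam i - w)\<^sup>2"
proof -
  note [simp] = S_moments(1-3)[OF assms]
  have e: "integrable M (\<lambda>\<omega>. (S i \<omega> - w)\<^sup>2)"
    "M.expectation (\<lambda>\<omega>. (S i \<omega> - w)\<^sup>2) = M.expectation (\<lambda>\<omega>. (S i \<omega>)\<^sup>2) - 2 * Lam i * w + w\<^sup>2" for w
    by (simp_all add: power2_diff M.prob_space)
  show "integrable M (\<lambda>\<omega>. (S i \<omega> - w)\<^sup>2)" by (rule e)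
  show "M.expectation (\<lambda>\<omega>. (S i \<omega> - w)\<^sup>2) = varS i + (Lam i - w)\<^sup>2"
    using e(2)[of w] e(2)[of "Lam i"] S_moments(4)[OF assms]
    by (simp add: power2_eq_square algebra_simps)
qed

text \<open>In the factor \<open>Tmax ^ 3\<close>, two powers come from bounding the sum by
  \<open>Tmax\<close> times its largest term, and one from summing over all terms in place of the
  largest.\<close>

lemma S_tail:
  assumes i: "1 \<le> i" and K: "0 < K"
  shows "integrable M (\<lambda>\<omega>. if K * scl i < S i \<omega> then (S i \<omega>)\<^sup>2 else 0)" (is "integrable M ?f")
    and "M.expectation (\<lambda>\<omega>. if K * scl i < S i \<omega> then (S i \<omega>)\<^sup>2 else 0)
      \<le> real Tmax ^ 3 * (scl i)\<^sup>2 * tail_bound (K / real Tmax)"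
proof -
  note [measurable] = S_rv[OF i]
  define g where "g = (\<lambda>t \<omega>. if K / real Tmax * scl i < real (N i t \<omega>) then (real (N i t \<omega>))\<^sup>2 else 0)"
  have g_nonneg: "0 \<le> g t \<omega>" for t \<omega> by (simp add: g_def)
  show f_int: "integrable M ?f"
    by (rule Bochner_Integration.integrable_bound[OF S_moments(1)[OF i]]) auto
  have g_int: "integrable M (g t)" if "t \<in> {1..T i}" for t
  proof -
    note [measurable] = mixed_poisson.count_measurable[OF mixed_poisson[OF i that]]
    show ?thesis unfolding g_def
      by (rule Bochner_Integration.integrable_bound
          [OF mixed_poisson.count_square_integrable[OF mixed_poisson[OF i that]]]) auto
  qed
  have g_exp: "M.expectation (g t) \<le> (scl i)\<^sup>2 * tail_bound (K / real Tmax)" if "t \<in> {1..T i}" for t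
    unfolding g_def
    by (rule mixed_poisson.count_tail[OF mixed_poisson[OF i that] scl_ge_1 lam_le_scl[OF that]])
       (use K Tmax_pos in auto)
  have tb: "0 \<le> (scl i)\<^sup>2 * tail_bound (K / real Tmax)"
    using K by (intro mult_nonneg_nonneg tail_bound_nonneg) auto
  \<comment> \<open>If the sum is large, then so is its largest term.\<close>
  have dom: "?f \<omega> \<le> (real Tmax)\<^sup>2 * (\<Sum>t\<in>{1..T i}. g t \<omega>)" for \<omega>
  proof (cases "K * scl i < S i \<omega>")
    case True
    have "0 < K * scl i" using K scl_ge_1[of i] by simp
    then have "0 < S i \<omega>" using True by simp
    have "\<exists>t\<in>{1..T i}. S i \<omega> / real Tmax \<le> real (N i t \<omega>)"
    proof (rule ccontr)
      assume "\<not> ?thesis"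
      then have less: "real (N i t \<omega>) < S i \<omega> / real Tmax" if "t \<in> {1..T i}" for t
        using that by (meson not_le)
      have "{1..T i} \<noteq> {}" using \<open>0 < S i \<omega>\<close> unfolding S_def by (metis sum.empty less_irrefl)
      then have "(\<Sum>t\<in>{1..T i}. real (N i t \<omega>)) < (\<Sum>t\<in>{1..T i}. S i \<omega> / real Tmax)"
        by (intro sum_strict_mono less) auto
      also have "\<dots> = real (T i) * (S i \<omega> / real Tmax)" by simp
      also have "\<dots> \<le> real Tmax * (S i \<omega> / real Tmax)"
        using T_le[of i] \<open>0 < S i \<omega>\<close> by (intro mult_right_mono) auto
      finally show False using Tmax_pos by (simp add: S_def)
    qed
    then obtain t where t: "t \<in> {1..T i}" "S i \<omega> / real Tmax \<le> real (N i t \<omega>)" by auto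
    have "K / real Tmax * scl i < S i \<omega> / real Tmax"
      using True Tmax_pos by (simp add: divide_strict_right_mono)
    then have gt: "g t \<omega> = (real (N i t \<omega>))\<^sup>2" using t by (simp add: g_def)
    have "S i \<omega> \<le> real Tmax * real (N i t \<omega>)" using t Tmax_pos by (simp add: field_simps)
    then have "(S i \<omega>)\<^sup>2 \<le> (real Tmax * real (N i t \<omega>))\<^sup>2" using S_nonneg by (intro power_mono) auto
    also have "\<dots> = (real Tmax)\<^sup>2 * g t \<omega>" by (simp add: gt power_mult_distrib)
    also have "\<dots> \<le> (real Tmax)\<^sup>2 * (\<Sum>t\<in>{1..T i}. g t \<omega>)"
      using t g_nonneg by (intro mult_left_mono member_le_sum) auto
    finally show ?thesis using True by simp
  next
    case False
    then show ?thesis using g_nonneg by (simp add: sum_nonneg)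
  qed
  have "M.expectation ?f \<le> M.expectation (\<lambda>\<omega>. (real Tmax)\<^sup>2 * (\<Sum>t\<in>{1..T i}. g t \<omega>))"
    using dom by (intro integral_mono f_int integrable_mult_right Bochner_Integration.integrable_sum g_int)
  also have "\<dots> = (real Tmax)\<^sup>2 * (\<Sum>t\<in>{1..T i}. M.expectation (g t))"
    using g_int by simp
  also have "\<dots> \<le> (real Tmax)\<^sup>2 * (\<Sum>t\<in>{1..T i}. (scl i)\<^sup>2 * tail_bound (K / real Tmax))"
    by (intro mult_left_mono sum_mono g_exp) auto
  also have "\<dots> = (real Tmax)\<^sup>2 * (real (T i) * ((scl i)\<^sup>2 * tail_bound (K / real Tmax)))" by simp
  also have "\<dots> \<le> (real Tmax)\<^sup>2 * (real Tmax * ((scl i)\<^sup>2 * tail_bound (K / real Tmax)))"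
    using T_le[of i] tb by (intro mult_left_mono mult_right_mono) auto
  finally show "M.expectation ?f \<le> real Tmax ^ 3 * (scl i)\<^sup>2 * tail_bound (K / real Tmax)"
    by (simp add: power2_eq_square power3_eq_cube mult_ac)
qed

text \<open>Truncation loses at most \<open>2 * (S i)\<^sup>2\<close> on the event that it takes
  effect, and \<open>S_tail\<close> bounds the mean of that loss. Discarding the squared bias
  \<open>(Lam i - w)\<^sup>2\<close> makes the lower bound uniform in \<open>w\<close>.\<close>

lemma truncated_square_expectation:
  assumes i: "1 \<le> i" and K: "0 < K" and w: "0 \<le> w"
  shows "varS i - 2 * real Tmax ^ 3 * (scl i)\<^sup>2 * tail_bound (K / real Tmax)
      \<le> M.expectation (\<lambda>\<omega>. (min (S i \<omega>) (K * scl i) - w)\<^sup>2)"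
proof -
  note [measurable] = S_rv[OF i]
  let ?f = "\<lambda>\<omega>. if K * scl i < S i \<omega> then (S i \<omega>)\<^sup>2 else 0"
  have Ks: "0 < K * scl i" using K scl_ge_1[of i] by simp
  have int: "integrable M (\<lambda>\<omega>. (min (S i \<omega>) (K * scl i) - w)\<^sup>2)"
  proof (rule M.integrable_const_bound)
    show "AE \<omega> in M. norm ((min (S i \<omega>) (K * scl i) - w)\<^sup>2) \<le> (K * scl i + w)\<^sup>2"
    proof (rule AE_I2)
      fix \<omega>
      have "\<bar>min (S i \<omega>) (K * scl i) - w\<bar> \<le> \<bar>K * scl i + w\<bar>"
        using w Ks S_nonneg[of i \<omega>] by linarith
      then show "norm ((min (S i \<omega>) (K * scl i) - w)\<^sup>2) \<le> (K * scl i + w)\<^sup>2"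
        by (simp add: abs_le_square_iff)
    qed
  qed measurable
  have "(S i \<omega> - w)\<^sup>2 \<le> (min (S i \<omega>) (K * scl i) - w)\<^sup>2 + 2 * ?f \<omega>" for \<omega>
  proof (cases "K * scl i < S i \<omega>")
    case True
    define y where "y = K * scl i"
    have y: "0 \<le> y" "y \<le> S i \<omega>" using Ks True by (auto simp: y_def)
    have "(S i \<omega> - w)\<^sup>2 - (y - w)\<^sup>2 = (S i \<omega> - y) * (S i \<omega> + y - 2 * w)"
      by (simp add: power2_eq_square algebra_simps)
    also have "\<dots> \<le> (S i \<omega> - y) * (2 * S i \<omega>)" using y w by (intro mult_left_mono) auto
    also have "\<dots> \<le> S i \<omega> * (2 * S i \<omega>)" using y by (intro mult_right_mono) auto
    finally show ?thesis using True by (simp add: y_def power2_eq_square)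
  qed simp
  then have "M.expectation (\<lambda>\<omega>. (S i \<omega> - w)\<^sup>2)
      \<le> M.expectation (\<lambda>\<omega>. (min (S i \<omega>) (K * scl i) - w)\<^sup>2 + 2 * ?f \<omega>)"
    by (intro integral_mono expectation_square_diff(1)[OF i] Bochner_Integration.integrable_add int
        integrable_mult_right S_tail(1)[OF i K])
  also have "\<dots> = M.expectation (\<lambda>\<omega>. (min (S i \<omega>) (K * scl i) - w)\<^sup>2) + 2 * M.expectation ?f"
    using int S_tail(1)[OF i K] by simp
  finally show ?thesis
    using S_tail(2)[OF i K] expectation_square_diff(2)[OF i, of w] zero_le_power2[of "Lam i - w"]
    by linarith
qed

lemma sum_S_deviation:
  assumes "0 < a"
  shows "M.prob {\<omega>\<in>space M. a \<le> \<bar>(\<Sum>i\<in>{1..k}. S i \<omega>) - (\<Sum>i\<in>{1..k}. Lam i)\<bar>}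
    \<le> (\<Sum>i\<in>{1..k}. varS i) / a\<^sup>2"
proof -
  have indep: "M.indep_vars (\<lambda>_. borel) S {1..k}"
    by (rule M.indep_vars_subset[OF S_indep]) auto
  have sq: "integrable M (\<lambda>\<omega>. (S i \<omega>)\<^sup>2)" "M.expectation (S i) = Lam i" "integrable M (S i)"
    if "i \<in> {1..k}" for i
    using S_moments[of i] that by auto
  have var: "integrable M (\<lambda>\<omega>. (\<Sum>i\<in>{1..k}. S i \<omega>)\<^sup>2)"
    "M.expectation (\<lambda>\<omega>. ((\<Sum>i\<in>{1..k}. S i \<omega>) - (\<Sum>i\<in>{1..k}. Lam i))\<^sup>2)
      = (\<Sum>i\<in>{1..k}. M.expectation (\<lambda>\<omega>. (S i \<omega> - Lam i)\<^sup>2))"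
    using M.variance_sum_indep[OF _ indep sq(1,2)] by auto
  have mean: "M.expectation (\<lambda>\<omega>. \<Sum>i\<in>{1..k}. S i \<omega>) = (\<Sum>i\<in>{1..k}. Lam i)"
    using sq by simp
  have "(\<lambda>\<omega>. \<Sum>i\<in>{1..k}. S i \<omega>) \<in> borel_measurable M"
    by (intro borel_measurable_sum S_rv) auto
  from M.Chebyshev_inequality[OF this var(1) assms] show ?thesis
    unfolding mean var(2) using S_moments(4) by simp
qed

lemma sum_S_square_tail:
  assumes "0 < a"
  shows "M.prob {\<omega>\<in>space M. a \<le> (\<Sum>i\<in>{1..k}. (S i \<omega>)\<^sup>2)}
    \<le> (\<Sum>i\<in>{1..k}. varS i + (Lam i)\<^sup>2) / a"
proof -
  have int: "integrable M (\<lambda>\<omega>. (S i \<omega>)\<^sup>2)"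
    and ex: "M.expectation (\<lambda>\<omega>. (S i \<omega>)\<^sup>2) = varS i + (Lam i)\<^sup>2" if "i \<in> {1..k}" for i
    using expectation_square_diff[of i 0] that by auto
  have "M.prob {\<omega>\<in>space M. a \<le> (\<Sum>i\<in>{1..k}. (S i \<omega>)\<^sup>2)}
      \<le> M.expectation (\<lambda>\<omega>. \<Sum>i\<in>{1..k}. (S i \<omega>)\<^sup>2) / a"
    by (rule integral_Markov_inequality_measure[where A = "{}" ])
       (use int assms in \<open>auto intro!: sum_nonneg\<close>)
  also have "M.expectation (\<lambda>\<omega>. \<Sum>i\<in>{1..k}. (S i \<omega>)\<^sup>2) = (\<Sum>i\<in>{1..k}. varS i + (Lam i)\<^sup>2)"
    using int ex by simp
  finally show ?thesis .
qed

text \<open>The sum of squared rates is at most the square of their sum.\<close>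

lemma varS_le: "varS i \<le> (1 + tau2) * (scl i)\<^sup>2"
proof -
  have "(\<Sum>t\<in>{1..T i}. (lam i t)\<^sup>2) \<le> (\<Sum>t\<in>{1..T i}. lam i t * Lam i)"
    unfolding power2_eq_square
    using lam_pos member_le_sum[of _ "{1..T i}" "lam i"]
    by (intro sum_mono mult_left_mono) (auto simp: Lam_def less_imp_le)
  also have "\<dots> = Lam i * Lam i" by (simp add: Lam_def sum_distrib_right)
  finally have "tau2 * (\<Sum>t\<in>{1..T i}. (lam i t)\<^sup>2) \<le> tau2 * (Lam i * Lam i)"
    using tau2_nonneg by (intro mult_left_mono)
  moreover have "tau2 * (Lam i * Lam i) \<le> tau2 * (scl i)\<^sup>2"
    using tau2_nonneg Lam_nonneg[of i]
    by (intro mult_left_mono) (auto simp: scl_def power2_eq_square algebra_simps)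
  moreover have "Lam i \<le> (scl i)\<^sup>2"
    using Lam_nonneg[of i] by (simp add: scl_def power2_eq_square algebra_simps)
  ultimately show ?thesis by (simp add: varS_def algebra_simps)
qed

text \<open>By the Cauchy-Schwarz inequality over at most \<open>Tmax\<close> terms, the
  overdispersion is at least a fixed multiple of \<open>(Lam i)\<^sup>2\<close>, the quantity whose
  average has a positive limit.\<close>

lemma varS_ge: "Lam i + tau2 / real Tmax * (Lam i)\<^sup>2 \<le> varS i"
proof -
  have "(Lam i)\<^sup>2 \<le> (\<Sum>t\<in>{1..T i}. (lam i t)\<^sup>2) * real (card {1..T i})"
    unfolding Lam_def by (rule sum_squared_le_sum_of_squares)
  also have "\<dots> \<le> (\<Sum>t\<in>{1..T i}. (lam i t)\<^sup>2) * real Tmax"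
    using T_le[of i] by (intro mult_left_mono sum_nonneg) auto
  finally have "(Lam i)\<^sup>2 / real Tmax \<le> (\<Sum>t\<in>{1..T i}. (lam i t)\<^sup>2)"
    using Tmax_pos by (simp add: field_simps)
  then have "tau2 * ((Lam i)\<^sup>2 / real Tmax) \<le> tau2 * (\<Sum>t\<in>{1..T i}. (lam i t)\<^sup>2)"
    using tau2_nonneg by (intro mult_left_mono)
  then show ?thesis by (simp add: varS_def)
qed

end

text \<open>\<open>U\<close> need not be of order \<open>k\<close>, since the fitted rates range
  over all parameters. Because \<open>P\<close> is at least of order \<open>k\<close>, its square
  still beats both \<open>z\<^sup>2 * k * sqrt k\<close> and \<open>z\<^sup>2 * P\<close>. Comparing
  squares covers negative \<open>z\<close> as well.\<close>

lemma score_ratio_ge: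
  fixes P U z d :: real and k :: nat
  assumes P: "d * real k \<le> P" and d: "0 < d" and U: "0 < U" "U \<le> 4 * (real k * sqrt (real k)) + 2 * P"
    and k: "1 \<le> k" "8 * z\<^sup>2 \<le> d * real k" "16 * z\<^sup>2 \<le> d\<^sup>2 * sqrt (real k)"
  shows "z \<le> P / sqrt (2 * U)"
proof -
  define r where "r = sqrt (real k)"
  have r: "0 < r" "real k = r * r" using k by (auto simp: r_def)
  have dk: "0 < d * real k" using d k by simp
  then have P_pos: "0 < P" using P by linarith
  have kr: "0 \<le> real k * r" using r(1) by simp
  have zP: "8 * z\<^sup>2 \<le> P" using P k by linarith
  have zr: "16 * z\<^sup>2 \<le> d\<^sup>2 * r" using k by (simp add: r_def)
  have "z\<^sup>2 * (2 * U) \<le> z\<^sup>2 * (2 * (4 * (real k * r) + 2 * P))"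
    using U by (intro mult_left_mono) (auto simp: r_def)
  also have "\<dots> = 8 * z\<^sup>2 * P / 2 + 16 * z\<^sup>2 * (real k * r) / 2" by (simp add: algebra_simps)
  also have "\<dots> \<le> P * P / 2 + d\<^sup>2 * r * (real k * r) / 2"
    using mult_right_mono[OF zP, of P] mult_right_mono[OF zr kr] P_pos by linarith
  also have "d\<^sup>2 * r * (real k * r) = (d * real k) * (d * real k)"
    by (simp add: r(2) power2_eq_square)
  also have "P * P / 2 + (d * real k) * (d * real k) / 2 \<le> P * P / 2 + P * P / 2"
    using P dk by (intro add_mono divide_right_mono mult_mono) auto
  finally have "(z * sqrt (2 * U))\<^sup>2 \<le> P\<^sup>2"
    using U by (simp add: power_mult_distrib power2_eq_square[of P])
  then have "z * sqrt (2 * U) \<le> P" by (rule power2_le_imp_le) (use P_pos in simp)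
  then show ?thesis using U by (simp add: pos_le_divide_eq)
qed

section \<open>Asymptotics when the average of the squared row means converges\<close>

context saturated_model
begin

lemma scl_square_le: "(scl i)\<^sup>2 \<le> 2 + 2 * (Lam i)\<^sup>2"
  using sum_squares_bound[of 1 "Lam i"] by (simp add: scl_def power2_eq_square algebra_simps)

context
  fixes c :: real
  assumes c_pos: "0 < c"
    and Lam_average: "(\<lambda>k. (1 / real k) * (\<Sum>i\<in>{1..k}. (Lam i)\<^sup>2)) \<longlonglongrightarrow> c"
begin

lemma sum_scl_square_le:
  "\<forall>\<^sub>F k in sequentially. (\<Sum>i\<in>{1..k}. (scl i)\<^sup>2) \<le> (2 * c + 4) * real k"
proof -
  have "\<forall>\<^sub>F k in sequentially. (1 / real k) * (\<Sum>i\<in>{1..k}. (Lam i)\<^sup>2) < c + 1"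
    using Lam_average by (rule order_tendstoD(2)) simp
  then show ?thesis
    using eventually_ge_at_top[of "1::nat"]
  proof eventually_elim
    case (elim k)
    have "(\<Sum>i\<in>{1..k}. (scl i)\<^sup>2) \<le> (\<Sum>i\<in>{1..k}. 2 + 2 * (Lam i)\<^sup>2)"
      by (intro sum_mono scl_square_le)
    also have "\<dots> = 2 * real k + 2 * (\<Sum>i\<in>{1..k}. (Lam i)\<^sup>2)"
      by (simp add: sum.distrib sum_distrib_left)
    finally show ?case using elim by (simp add: field_simps)
  qed
qed

lemma scl_square_sublinear:
  assumes "0 < \<epsilon>"
  shows "\<forall>\<^sub>F k in sequentially. \<forall>i\<in>{1..k}. (scl i)\<^sup>2 \<le> \<epsilon> * real k"
proof -
  have "\<forall>\<^sub>F k in sequentially. \<forall>i\<in>{1..k}. (Lam i)\<^sup>2 \<le> (\<epsilon> / 4) * real k"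
    using assms by (intro terms_sublinear_if_averages_converge[OF _ Lam_average]) auto
  moreover have "\<forall>\<^sub>F k in sequentially. 2 \<le> (\<epsilon> / 2) * real k"
    using assms by real_asymp
  ultimately show ?thesis
  proof eventually_elim
    case (elim k)
    show ?case
    proof
      fix i assume "i \<in> {1..k}"
      then have "(Lam i)\<^sup>2 \<le> (\<epsilon> / 4) * real k" using elim by blast
      then show "(scl i)\<^sup>2 \<le> \<epsilon> * real k" using elim scl_square_le[of i] by linarith
    qed
  qed
qed

text \<open>After truncating the row sums and rounding the fitted values, the uniform deviation
  bound applies. The mean of the residual sum exceeds the sum of the \<open>Lam i\<close> by a
  multiple of \<open>k\<close> large enough to pay for fluctuation, rounding and truncation. The
  exceptional event does not depend on \<open>b\<close>.\<close>

lemma residual_sum_uniform_lower_bound: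
  fixes x :: "nat \<Rightarrow> nat \<Rightarrow> 'v::euclidean_space"
  assumes tau2: "0 < tau2"
  obtains \<delta> Bad where "0 < \<delta>" "\<And>k. Bad k \<in> M.events" "(\<lambda>k. M.prob (Bad k)) \<longlonglongrightarrow> 0"
    "\<forall>\<^sub>F k in sequentially. \<forall>\<omega>\<in>space M - Bad k. \<forall>b. (\<Sum>i\<in>{1..k}. Lam i) + \<delta> * real k
       \<le> (\<Sum>i\<in>{1..k}. (S i \<omega> - (\<Sum>t\<in>{1..T i}. exp (x i t \<bullet> b)))\<^sup>2)"
proof -
  define C where "C = 2 * c + 4"
  \<comment> \<open>Since \<open>c / 2\<close> is eventually below the average of the
    \<open>(Lam i)\<^sup>2\<close>, the overdispersion is at least
    \<open>4 * \<delta> * real k\<close>. Three losses of \<open>\<delta> * real k\<close> leave one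
    such share.\<close>
  define \<delta> where "\<delta> = tau2 / real Tmax * (c / 2) / 4"
  have C: "0 < C" using c_pos by (simp add: C_def)
  have \<delta>: "0 < \<delta>" using tau2 Tmax_pos c_pos by (simp add: \<delta>_def)
  \<comment> \<open>The truncation level is fixed first. The number of grid levels comes after it,
    because the rounding error grows with \<open>K\<^sup>2\<close>.\<close>
  have "(\<lambda>n. 2 * real Tmax ^ 3 * tail_bound (real n) * C) \<longlonglongrightarrow> 2 * real Tmax ^ 3 * 0 * C"
    by (intro tendsto_mult tendsto_const tail_bound_tendsto_0)
  then have "\<forall>\<^sub>F n in sequentially. 2 * real Tmax ^ 3 * tail_bound (real n) * C < \<delta>"
    using \<delta> by (intro order_tendstoD(2)) auto
  then have "\<forall>\<^sub>F n in sequentially. 2 * real Tmax ^ 3 * tail_bound (real n) * C < \<delta> \<and> 1 \<le> n"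
    using eventually_ge_at_top[of "1::nat"] by eventually_elim auto
  then obtain n where n: "1 \<le> n" "2 * real Tmax ^ 3 * tail_bound (real n) * C < \<delta>"
    by (auto simp: eventually_sequentially)
  define K where "K = real n * real Tmax"
  have K: "0 < K" "K / real Tmax = real n" using n Tmax_pos by (auto simp: K_def)
  have "\<forall>\<^sub>F L in sequentially. 2 * real Tmax * K\<^sup>2 / real L * C < \<delta> \<and> 1 \<le> L"
  proof (intro eventually_conj eventually_ge_at_top)
    have "(\<lambda>L. 2 * real Tmax * K\<^sup>2 / real L * C) \<longlonglongrightarrow> 0 * C"
      by (intro tendsto_mult tendsto_const lim_const_over_n)
    then show "\<forall>\<^sub>F L in sequentially. 2 * real Tmax * K\<^sup>2 / real L * C < \<delta>"
      using \<delta> by (intro order_tendstoD(2)) auto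
  qed
  then obtain L :: nat where L: "1 \<le> L" "2 * real Tmax * K\<^sup>2 / real L * C < \<delta>"
    by (auto simp: eventually_sequentially)
  \<comment> \<open>The grid ends exactly at the truncation level \<open>K * scl i\<close>, so its
    cap and the clipping of \<open>S i\<close> agree.\<close>
  define g where "g = (\<lambda>i. K / real L * scl i)"
  have g: "0 < g i" "g i * real L = K * scl i" for i
    using K L scl_ge_1[of i] by (auto simp: g_def)
  define Y where "Y = (\<lambda>i \<omega>. min (S i \<omega>) (K * scl i))"
  define u where "u = (\<lambda>i b. \<Sum>t\<in>{1..T i}. exp (x i t \<bullet> b))"
  define v where "v = (\<lambda>i b. min (\<Sum>t\<in>{1..T i}. g i * real (card {l\<in>{1..L}. real l * g i \<le> exp (x i t \<bullet> b)}))
                        (g i * real L))"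
  have Ks: "0 < K * scl i" for i using K scl_ge_1[of i] by simp
  have Y: "0 \<le> Y i \<omega> \<and> Y i \<omega> \<le> K * scl i" for i \<omega>
    using S_nonneg[of i \<omega>] Ks[of i] by (simp add: Y_def)
  have v: "0 \<le> v i b \<and> v i b \<le> K * scl i" for i b
  proof -
    have "0 \<le> (\<Sum>t\<in>{1..T i}. g i * real (card {l\<in>{1..L}. real l * g i \<le> exp (x i t \<bullet> b)}))"
      using g(1)[of i] by (intro sum_nonneg mult_nonneg_nonneg) auto
    then show ?thesis using Ks[of i] by (simp add: v_def g(2))
  qed
  have Y_indep: "M.indep_vars (\<lambda>_. borel) Y {1..}"
    unfolding Y_def by (rule M.indep_vars_compose2[OF S_indep, where Y = "\<lambda>i y. min y (K * scl i)"]) auto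
  have fin: "finite (range (\<lambda>b. restrict (\<lambda>i. v i b) G))"
    and growth: "card (range (\<lambda>b. restrict (\<lambda>i. v i b) G)) \<le> (Tmax * L * card G + 1) ^ DIM('v)"
    if "finite G" for G
    unfolding v_def using card_quantised_rate_patterns[OF that g(1) T_le, where L = L and x = x] by auto
  define Bad where "Bad = (\<lambda>k. {\<omega>\<in>space M. \<exists>b. (\<Sum>i\<in>{1..k}. (Y i \<omega> - v i b)\<^sup>2)
      < (\<Sum>i\<in>{1..k}. M.expectation (\<lambda>\<omega>. (Y i \<omega> - v i b)\<^sup>2)) - \<delta> * real k})"
  have Bad_ev: "Bad k \<in> M.events" for k
    unfolding Bad_def
  proof (rule M.square_deviation_event(2)[OF _ fin])
    fix i assume "i \<in> {1..k}"
    then show "M.random_variable borel (Y i)"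
      unfolding Y_def using S_rv[of i] by simp
  qed simp
  have Bad_lim: "(\<lambda>k. M.prob (Bad k)) \<longlonglongrightarrow> 0"
    unfolding Bad_def
    by (rule M.uniform_square_deviation_tendsto_0[OF Y_indep Y v K(1) scl_ge_1 fin growth C
          sum_scl_square_le[folded C_def] scl_square_sublinear \<delta>])
  have "\<forall>\<^sub>F k in sequentially. c / 2 < (1 / real k) * (\<Sum>i\<in>{1..k}. (Lam i)\<^sup>2)"
    using Lam_average by (rule order_tendstoD(1)) (use c_pos in simp)
  then have "\<forall>\<^sub>F k in sequentially. \<forall>\<omega>\<in>space M - Bad k. \<forall>b. (\<Sum>i\<in>{1..k}. Lam i) + \<delta> * real k
       \<le> (\<Sum>i\<in>{1..k}. (S i \<omega> - u i b)\<^sup>2)"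
    using sum_scl_square_le[folded C_def] eventually_ge_at_top[of "1::nat"]
  proof eventually_elim
    case (elim k)
    show ?case
    proof (intro ballI allI)
      fix \<omega> b assume \<omega>: "\<omega> \<in> space M - Bad k"
      let ?q = "2 * real Tmax * K\<^sup>2 / real L" and ?r = "2 * real Tmax ^ 3 * tail_bound (real n)"
      \<comment> \<open>Clipping both values only decreases the square. Rounding then changes it by
        a difference of squares, a factor of at most \<open>Tmax * g i\<close> times one of at most
        \<open>2 * K * scl i\<close>.\<close>
      have quant: "(Y i \<omega> - v i b)\<^sup>2 \<le> (S i \<omega> - u i b)\<^sup>2 + ?q * (scl i)\<^sup>2" for i
      proof -
        define u' where "u' = min (u i b) (K * scl i)"
        have "0 \<le> u i b" unfolding u_def by (intro sum_nonneg) auto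
        then have u': "0 \<le> u'" "u' \<le> K * scl i" using Ks[of i] by (auto simp: u'_def)
        have "\<bar>v i b - u'\<bar> \<le> real (card {1..T i}) * g i"
          unfolding v_def u'_def u_def g(2)[symmetric]
          by (rule sum_quantisation_error) (use g in auto)
        also have "\<dots> \<le> real Tmax * g i"
          using T_le[of i] g(1)[of i] by (intro mult_right_mono) auto
        finally have d: "\<bar>u' - v i b\<bar> \<le> real Tmax * g i" by linarith
        have e: "\<bar>2 * Y i \<omega> - u' - v i b\<bar> \<le> 2 * (K * scl i)"
          using Y[of i \<omega>] v[of i b] u' by linarith
        have "(Y i \<omega> - v i b)\<^sup>2 - (Y i \<omega> - u')\<^sup>2 = (u' - v i b) * (2 * Y i \<omega> - u' - v i b)"
          by (simp add: power2_eq_square algebra_simps)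
        also have "\<dots> \<le> \<bar>u' - v i b\<bar> * \<bar>2 * Y i \<omega> - u' - v i b\<bar>"
          by (metis abs_ge_self abs_mult)
        also have "\<dots> \<le> (real Tmax * g i) * (2 * (K * scl i))"
          using d e g(1)[of i] by (intro mult_mono) auto
        also have "\<dots> = ?q * (scl i)\<^sup>2" by (simp add: g_def power2_eq_square)
        finally show ?thesis
          using clip_square_le[of "S i \<omega>" "K * scl i" "u i b"] by (simp add: Y_def u'_def)
      qed
      have "(\<Sum>i\<in>{1..k}. M.expectation (\<lambda>\<omega>. (Y i \<omega> - v i b)\<^sup>2)) - \<delta> * real k
          \<le> (\<Sum>i\<in>{1..k}. (Y i \<omega> - v i b)\<^sup>2)"
        using \<omega> unfolding Bad_def by (auto simp: not_less)
      also have "\<dots> \<le> (\<Sum>i\<in>{1..k}. (S i \<omega> - u i b)\<^sup>2 + ?q * (scl i)\<^sup>2)"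
        by (intro sum_mono quant)
      finally have 1: "(\<Sum>i\<in>{1..k}. M.expectation (\<lambda>\<omega>. (Y i \<omega> - v i b)\<^sup>2)) - \<delta> * real k
          \<le> (\<Sum>i\<in>{1..k}. (S i \<omega> - u i b)\<^sup>2) + ?q * (\<Sum>i\<in>{1..k}. (scl i)\<^sup>2)"
        by (simp add: sum.distrib sum_distrib_left)
      have "(\<Sum>i\<in>{1..k}. Lam i + tau2 / real Tmax * (Lam i)\<^sup>2 - ?r * (scl i)\<^sup>2)
          \<le> (\<Sum>i\<in>{1..k}. M.expectation (\<lambda>\<omega>. (Y i \<omega> - v i b)\<^sup>2))"
      proof (rule sum_mono)
        fix i assume "i \<in> {1..k}"
        then have "varS i - 2 * real Tmax ^ 3 * (scl i)\<^sup>2 * tail_bound (K / real Tmax)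
            \<le> M.expectation (\<lambda>\<omega>. (Y i \<omega> - v i b)\<^sup>2)"
          unfolding Y_def by (intro truncated_square_expectation) (use K v in auto)
        then show "Lam i + tau2 / real Tmax * (Lam i)\<^sup>2 - ?r * (scl i)\<^sup>2
            \<le> M.expectation (\<lambda>\<omega>. (Y i \<omega> - v i b)\<^sup>2)"
          using varS_ge[of i] unfolding K(2) by (simp add: mult_ac)
      qed
      then have 2: "(\<Sum>i\<in>{1..k}. Lam i) + tau2 / real Tmax * (\<Sum>i\<in>{1..k}. (Lam i)\<^sup>2)
          - ?r * (\<Sum>i\<in>{1..k}. (scl i)\<^sup>2)
          \<le> (\<Sum>i\<in>{1..k}. M.expectation (\<lambda>\<omega>. (Y i \<omega> - v i b)\<^sup>2))"
        by (simp add: sum_subtractf sum.distrib sum_distrib_left)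
      have small: "a * (\<Sum>i\<in>{1..k}. (scl i)\<^sup>2) \<le> \<delta> * real k" if "0 \<le> a" "a * C < \<delta>" for a
      proof -
        have "a * (\<Sum>i\<in>{1..k}. (scl i)\<^sup>2) \<le> a * (C * real k)"
          using elim that by (intro mult_left_mono) auto
        also have "\<dots> \<le> \<delta> * real k"
          using that mult_right_mono[of "a * C" \<delta> "real k"] by (simp add: mult.assoc)
        finally show ?thesis .
      qed
      have 3: "?q * (\<Sum>i\<in>{1..k}. (scl i)\<^sup>2) \<le> \<delta> * real k"
        using L by (intro small) auto
      have 4: "?r * (\<Sum>i\<in>{1..k}. (scl i)\<^sup>2) \<le> \<delta> * real k"
        using n tail_bound_nonneg[of "real n"] by (intro small) auto
      have "tau2 / real Tmax * (c / 2 * real k) \<le> tau2 / real Tmax * (\<Sum>i\<in>{1..k}. (Lam i)\<^sup>2)"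
        using elim tau2 by (intro mult_left_mono) (auto simp: field_simps)
      then have 5: "4 * (\<delta> * real k) \<le> tau2 / real Tmax * (\<Sum>i\<in>{1..k}. (Lam i)\<^sup>2)"
        by (simp add: \<delta>_def mult_ac)
      show "(\<Sum>i\<in>{1..k}. Lam i) + \<delta> * real k \<le> (\<Sum>i\<in>{1..k}. (S i \<omega> - u i b)\<^sup>2)"
        using 1 2 3 4 5 by linarith
    qed
  qed
  then show ?thesis
    using that[OF \<delta> Bad_ev Bad_lim] unfolding u_def by blast
qed

text \<open>The variance of the total is of order at most \<open>k\<close>, so Chebyshev's
  inequality at distance \<open>d * k\<close> gives the rate \<open>1 / k\<close>.\<close>

lemma sum_S_deviation_tendsto_0:
  assumes d: "0 < d"
  shows "(\<lambda>k. M.prob {\<omega>\<in>space M. d * real k \<le> \<bar>(\<Sum>i\<in>{1..k}. S i \<omega>) - (\<Sum>i\<in>{1..k}. Lam i)\<bar>}) \<longlonglongrightarrow> 0"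
proof (rule tendsto_sandwich[OF _ _ tendsto_const])
  let ?C = "(1 + tau2) * (2 * c + 4) / d\<^sup>2"
  show "(\<lambda>k. ?C / real k) \<longlonglongrightarrow> 0" by (rule lim_const_over_n)
  show "\<forall>\<^sub>F k in sequentially. M.prob {\<omega>\<in>space M. d * real k
      \<le> \<bar>(\<Sum>i\<in>{1..k}. S i \<omega>) - (\<Sum>i\<in>{1..k}. Lam i)\<bar>} \<le> ?C / real k"
    using sum_scl_square_le eventually_ge_at_top[of "1::nat"]
  proof eventually_elim
    case (elim k)
    have "(\<Sum>i\<in>{1..k}. varS i) \<le> (\<Sum>i\<in>{1..k}. (1 + tau2) * (scl i)\<^sup>2)"
      by (intro sum_mono varS_le)
    also have "\<dots> = (1 + tau2) * (\<Sum>i\<in>{1..k}. (scl i)\<^sup>2)" by (simp add: sum_distrib_left)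
    also have "\<dots> \<le> (1 + tau2) * ((2 * c + 4) * real k)"
      using elim tau2_nonneg by (intro mult_left_mono) auto
    finally have "(\<Sum>i\<in>{1..k}. varS i) / (d * real k)\<^sup>2
        \<le> (1 + tau2) * ((2 * c + 4) * real k) / (d * real k)\<^sup>2"
      by (rule divide_right_mono) simp
    also have "\<dots> = ?C / real k" using elim by (simp add: power2_eq_square)
    finally show ?case
      using sum_S_deviation[of "d * real k" k] d elim by simp
  qed
qed simp

text \<open>Markov's inequality. The level lies strictly between \<open>k\<close>, which bounds the
  order of the expectation, and \<open>k\<^sup>2\<close>, the least order of the squared
  numerator.\<close>

lemma sum_S_square_tail_tendsto_0:
  "(\<lambda>k. M.prob {\<omega>\<in>space M. real k * sqrt (real k) \<le> (\<Sum>i\<in>{1..k}. (S i \<omega>)\<^sup>2)}) \<longlonglongrightarrow> 0"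
proof (rule tendsto_sandwich[OF _ _ tendsto_const])
  let ?C = "(2 + tau2) * (2 * c + 4)"
  show "(\<lambda>k. ?C / sqrt (real k)) \<longlonglongrightarrow> 0" by real_asymp
  show "\<forall>\<^sub>F k in sequentially. M.prob {\<omega>\<in>space M. real k * sqrt (real k)
      \<le> (\<Sum>i\<in>{1..k}. (S i \<omega>)\<^sup>2)} \<le> ?C / sqrt (real k)"
    using sum_scl_square_le eventually_ge_at_top[of "1::nat"]
  proof eventually_elim
    case (elim k)
    have "varS i + (Lam i)\<^sup>2 \<le> (2 + tau2) * (scl i)\<^sup>2" for i
    proof -
      have "(Lam i)\<^sup>2 \<le> (scl i)\<^sup>2" using Lam_nonneg[of i] by (intro power_mono) (auto simp: scl_def)
      then show ?thesis using varS_le[of i] by (simp add: algebra_simps)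
    qed
    then have "(\<Sum>i\<in>{1..k}. varS i + (Lam i)\<^sup>2) \<le> (\<Sum>i\<in>{1..k}. (2 + tau2) * (scl i)\<^sup>2)"
      by (intro sum_mono)
    also have "\<dots> = (2 + tau2) * (\<Sum>i\<in>{1..k}. (scl i)\<^sup>2)" by (simp add: sum_distrib_left)
    also have "\<dots> \<le> (2 + tau2) * ((2 * c + 4) * real k)"
      using elim tau2_nonneg by (intro mult_left_mono) auto
    finally have "(\<Sum>i\<in>{1..k}. varS i + (Lam i)\<^sup>2) / (real k * sqrt (real k))
        \<le> (2 + tau2) * ((2 * c + 4) * real k) / (real k * sqrt (real k))"
      by (rule divide_right_mono) simp
    also have "\<dots> = ?C / sqrt (real k)" using elim by simp
    finally show ?case
      using sum_S_square_tail[of "real k * sqrt (real k)" k] elim by simp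
  qed
qed simp

text \<open>Numerator and denominator are controlled for all \<open>b\<close> at once, so the bound
  holds at whatever value an estimator takes.\<close>

lemma T_pin_uniformly_large:
  fixes x :: "nat \<Rightarrow> nat \<Rightarrow> real^'p"
  assumes tau2: "0 < tau2"
  obtains Bad where "\<And>k. Bad k \<in> M.events" "(\<lambda>k. M.prob (Bad k)) \<longlonglongrightarrow> 0"
    "\<forall>\<^sub>F k in sequentially. \<forall>\<omega>\<in>space M - Bad k. \<forall>b. z \<le> T_pin T x k (\<lambda>i t. N i t \<omega>) b"
proof -
  define u where "u = (\<lambda>i b. \<Sum>t\<in>{1..T i}. exp (x i t \<bullet> b))"
  obtain \<delta> B0 where \<delta>: "0 < \<delta>" and B0: "\<And>k. B0 k \<in> M.events" "(\<lambda>k. M.prob (B0 k)) \<longlonglongrightarrow> 0"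
    and lower: "\<forall>\<^sub>F k in sequentially. \<forall>\<omega>\<in>space M - B0 k. \<forall>b. (\<Sum>i\<in>{1..k}. Lam i) + \<delta> * real k
       \<le> (\<Sum>i\<in>{1..k}. (S i \<omega> - u i b)\<^sup>2)"
    unfolding u_def using residual_sum_uniform_lower_bound[OF tau2, of x] by blast
  define d where "d = \<delta> / 2"
  have d: "0 < d" using \<delta> by (simp add: d_def)
  \<comment> \<open>The residual bound refers to the sum of the \<open>Lam i\<close>, while the
    statistic subtracts the sum of the \<open>S i\<close>. Off \<open>B1\<close> the exchange costs
    half of \<open>\<delta> * real k\<close>.\<close>
  define B1 where "B1 = (\<lambda>k. {\<omega>\<in>space M. d * real k \<le> \<bar>(\<Sum>i\<in>{1..k}. S i \<omega>) - (\<Sum>i\<in>{1..k}. Lam i)\<bar>})"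
  define B2 where "B2 = (\<lambda>k. {\<omega>\<in>space M. real k * sqrt (real k) \<le> (\<Sum>i\<in>{1..k}. (S i \<omega>)\<^sup>2)})"
  have B1: "B1 k \<in> M.events" and B2: "B2 k \<in> M.events" for k
  proof -
    have [measurable]: "(\<lambda>\<omega>. \<Sum>i\<in>{1..k}. S i \<omega>) \<in> borel_measurable M"
      "(\<lambda>\<omega>. \<Sum>i\<in>{1..k}. (S i \<omega>)\<^sup>2) \<in> borel_measurable M"
      by (intro borel_measurable_sum borel_measurable_power S_rv; simp)+
    show "B1 k \<in> M.events" "B2 k \<in> M.events" unfolding B1_def B2_def by measurable
  qed
  define Bad where "Bad = (\<lambda>k. B0 k \<union> B1 k \<union> B2 k)"
  have Bad: "Bad k \<in> M.events" for k using B0 B1 B2 by (simp add: Bad_def)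
  have lim: "(\<lambda>k. M.prob (Bad k)) \<longlonglongrightarrow> 0"
  proof (rule tendsto_sandwich[OF _ _ tendsto_const])
    have "(\<lambda>k. M.prob (B0 k) + M.prob (B1 k) + M.prob (B2 k)) \<longlonglongrightarrow> 0 + 0 + 0"
      unfolding B1_def B2_def
      by (intro tendsto_add B0 sum_S_deviation_tendsto_0 sum_S_square_tail_tendsto_0 d)
    then show "(\<lambda>k. M.prob (B0 k) + M.prob (B1 k) + M.prob (B2 k)) \<longlonglongrightarrow> 0" by simp
    show "\<forall>\<^sub>F k in sequentially. M.prob (Bad k) \<le> M.prob (B0 k) + M.prob (B1 k) + M.prob (B2 k)"
    proof (rule always_eventually, rule allI)
      fix k
      have "M.prob (Bad k) \<le> M.prob (B0 k \<union> B1 k) + M.prob (B2 k)"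
        unfolding Bad_def using B0 B1 B2 by (intro measure_Un_le) auto
      moreover have "M.prob (B0 k \<union> B1 k) \<le> M.prob (B0 k) + M.prob (B1 k)"
        using B0 B1 by (intro measure_Un_le) auto
      ultimately show "M.prob (Bad k) \<le> M.prob (B0 k) + M.prob (B1 k) + M.prob (B2 k)" by linarith
    qed
  qed simp
  have "\<forall>\<^sub>F k in sequentially. 8 * z\<^sup>2 \<le> d * real k" using d by real_asymp
  moreover have "\<forall>\<^sub>F k in sequentially. 16 * z\<^sup>2 \<le> d\<^sup>2 * sqrt (real k)" using d by real_asymp
  ultimately have "\<forall>\<^sub>F k in sequentially. \<forall>\<omega>\<in>space M - Bad k. \<forall>b. z \<le> T_pin T x k (\<lambda>i t. N i t \<omega>) b"
    using lower eventually_ge_at_top[of "1::nat"]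
  proof eventually_elim
    case (elim k)
    show ?case
    proof (intro ballI allI)
      fix \<omega> b assume \<omega>: "\<omega> \<in> space M - Bad k"
      define P where "P = (\<Sum>i\<in>{1..k}. (S i \<omega> - u i b)\<^sup>2) - (\<Sum>i\<in>{1..k}. S i \<omega>)"
      define U where "U = (\<Sum>i\<in>{1..k}. (u i b)\<^sup>2)"
      have T_pin: "T_pin T x k (\<lambda>i t. N i t \<omega>) b = P / sqrt (2 * U)"
        by (simp add: T_pin_def P_def U_def S_def u_def sum_subtractf)
      have "(\<Sum>i\<in>{1..k}. Lam i) + \<delta> * real k \<le> (\<Sum>i\<in>{1..k}. (S i \<omega> - u i b)\<^sup>2)"
        using elim(3) \<omega> by (auto simp: Bad_def)
      moreover have "\<bar>(\<Sum>i\<in>{1..k}. S i \<omega>) - (\<Sum>i\<in>{1..k}. Lam i)\<bar> < d * real k"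
        using \<omega> by (auto simp: Bad_def B1_def)
      moreover have "\<delta> * real k = d * real k + d * real k" by (simp add: d_def)
      ultimately have P: "d * real k \<le> P" unfolding P_def by linarith
      have sq: "(\<Sum>i\<in>{1..k}. (S i \<omega>)\<^sup>2) < real k * sqrt (real k)"
        using \<omega> by (auto simp: Bad_def B2_def)
      \<comment> \<open>Row sums are natural numbers, so they are at most their squares.\<close>
      have "S i \<omega> \<le> (S i \<omega>)\<^sup>2" for i
      proof -
        have "S i \<omega> = real (\<Sum>t\<in>{1..T i}. N i t \<omega>)" by (simp add: S_def)
        then show ?thesis
          by (metis le_square of_nat_le_iff of_nat_power power2_eq_square)
      qed
      then have S_le: "(\<Sum>i\<in>{1..k}. S i \<omega>) \<le> (\<Sum>i\<in>{1..k}. (S i \<omega>)\<^sup>2)" by (intro sum_mono)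
      \<comment> \<open>Fitted values that are large compared with the counts enlarge the residuals
        as well, so \<open>U\<close> is controlled by the counts and by \<open>P\<close>
        itself.\<close>
      have "U \<le> (\<Sum>i\<in>{1..k}. 2 * (S i \<omega>)\<^sup>2 + 2 * (S i \<omega> - u i b)\<^sup>2)"
        unfolding U_def
      proof (rule sum_mono)
        fix i
        have "0 \<le> (2 * S i \<omega> - u i b)\<^sup>2" by simp
        then show "(u i b)\<^sup>2 \<le> 2 * (S i \<omega>)\<^sup>2 + 2 * (S i \<omega> - u i b)\<^sup>2"
          by (simp add: power2_eq_square algebra_simps)
      qed
      also have "\<dots> = 2 * (\<Sum>i\<in>{1..k}. (S i \<omega>)\<^sup>2) + 2 * (P + (\<Sum>i\<in>{1..k}. S i \<omega>))"
        by (simp add: P_def sum.distrib sum_distrib_left)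
      finally have U: "U \<le> 4 * (real k * sqrt (real k)) + 2 * P"
        using mult_left_mono[OF less_imp_le[OF sq], of 4] S_le by (simp add: algebra_simps)
      \<comment> \<open>Exponential rates are positive, so \<open>U = 0\<close> would mean that all
        rows are empty. Then \<open>P\<close> would vanish, contrary to its lower bound.\<close>
      have "0 < U"
      proof (rule ccontr)
        assume "\<not> 0 < U"
        moreover have "0 \<le> U" unfolding U_def by (intro sum_nonneg) auto
        ultimately have "(\<Sum>i\<in>{1..k}. (u i b)\<^sup>2) = 0" by (simp add: U_def)
        then have u0: "u i b = 0" if "i \<in> {1..k}" for i
          using that by (subst (asm) sum_nonneg_eq_0_iff) auto
        have "{1..T i} = {}" if "i \<in> {1..k}" for i
          using u0[OF that] sum_pos[of "{1..T i}" "\<lambda>t. exp (x i t \<bullet> b)"] unfolding u_def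
          by (metis exp_gt_zero finite_atLeastAtMost less_irrefl)
        then have "P = 0" using u0 by (simp add: P_def S_def)
        moreover have "0 < d * real k" using d elim by simp
        ultimately show False using P by simp
      qed
      then show "z \<le> T_pin T x k (\<lambda>i t. N i t \<omega>) b"
        unfolding T_pin by (intro score_ratio_ge[OF P d _ U]) (use elim in auto)
    qed
  qed
  then show ?thesis using that[OF Bad lim] by blast
qed

end

end

section \<open>Power of the score test in the saturated model\<close>

theorem theorem1:
  fixes M :: "'a measure"
    and T :: "nat \<Rightarrow> nat"
    and x :: "nat \<Rightarrow> nat \<Rightarrow> real^'p"
    and \<beta> :: "real^'p"
    and D :: "real measure"
    and \<theta> :: "nat \<Rightarrow> nat \<Rightarrow> 'a \<Rightarrow> real"
    and N :: "nat \<Rightarrow> nat \<Rightarrow> 'a \<Rightarrow> nat"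
    and \<beta>hat :: "nat \<Rightarrow> 'a \<Rightarrow> real^'p"
    and \<alpha> z :: real
  assumes M: "prob_space M"
    and Tbound: "\<exists>Tmax. \<forall>i. T i \<le> Tmax"
    and D: "prob_space D" "sets D = sets borel"
    and D_nonneg: "AE th in D. 0 \<le> th"
    and D_sq: "integrable D (\<lambda>th. th\<^sup>2)"
    and D_mean: "(\<integral>th. th \<partial>D) = 1"
    and D_var: "(\<integral>th. (th - 1)\<^sup>2 \<partial>D) > 0"
    and indep: "prob_space.indep_vars M (\<lambda>_. borel \<Otimes>\<^sub>M count_space UNIV)
                  (\<lambda>(i, t) \<omega>. (\<theta> i t \<omega>, N i t \<omega>)) {(i, t). 1 \<le> i \<and> 1 \<le> t \<and> t \<le> T i}"
    and cond: "\<And>i t A n. 1 \<le> i \<Longrightarrow> 1 \<le> t \<Longrightarrow> t \<le> T i \<Longrightarrow> A \<in> sets borel \<Longrightarrow>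
                 measure M {\<omega> \<in> space M. \<theta> i t \<omega> \<in> A \<and> N i t \<omega> = n}
                 = (LINT th:A|D. pois_pmf (th * exp (x i t \<bullet> \<beta>)) n)"
    and lam_lim: "\<exists>c>0. (\<lambda>k. (1 / real k) * (\<Sum>i\<in>{1..k}. (\<Sum>t\<in>{1..T i}. exp (x i t \<bullet> \<beta>))\<^sup>2))
                    \<longlonglongrightarrow> c"
    and mle_meas: "\<And>k. \<beta>hat k \<in> borel_measurable M"
    and mle: "\<And>k \<omega>. \<omega> \<in> space M \<Longrightarrow>
                (\<exists>b. is_pois_reg_mle T x k (\<lambda>i t. N i t \<omega>) b) \<Longrightarrow>
                is_pois_reg_mle T x k (\<lambda>i t. N i t \<omega>) (\<beta>hat k \<omega>)"
    and \<alpha>: "0 < \<alpha>" "\<alpha> < 1"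
    and z: "measure (density lborel std_normal_density) {..z} = 1 - \<alpha>"
  shows "(\<lambda>k. measure M {\<omega> \<in> space M. T_pin T x k (\<lambda>i t. N i t \<omega>) (\<beta>hat k \<omega>) \<ge> z})
           \<longlonglongrightarrow> 1"
proof -
  obtain Tm where Tm: "\<And>i. T i \<le> Tm" using Tbound by auto
  define lam where "lam = (\<lambda>i t. exp (x i t \<bullet> \<beta>))"
  interpret M: prob_space M by (rule M)
  \<comment> \<open>The successor makes the bound on the row lengths at least 1.\<close>
  interpret saturated_model D M T lam N "Suc Tm"
  proof (intro saturated_model.intro mixing_distribution.intro mixing_distribution_axioms.intro
      saturated_model_axioms.intro)
    \<comment> \<open>The random effects are integrated out: projecting the pairs to their second
      components keeps independence, and \<open>A = UNIV\<close> in \<open>cond\<close> gives the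
      marginal laws of the counts.\<close>
    have "M.indep_vars (\<lambda>_. count_space UNIV)
        (\<lambda>p \<omega>. snd ((\<lambda>(i, t) \<omega>. (\<theta> i t \<omega>, N i t \<omega>)) p \<omega>)) {(i, t). 1 \<le> i \<and> 1 \<le> t \<and> t \<le> T i}"
      by (rule M.indep_vars_compose2[OF indep]) auto
    then show "M.indep_vars (\<lambda>_. count_space UNIV) (\<lambda>(i, t). N i t)
        {(i, t). 1 \<le> i \<and> 1 \<le> t \<and> t \<le> T i}"
      by (simp add: case_prod_beta')
    show "measure M {\<omega> \<in> space M. N i t \<omega> = n} = (\<integral>th. pois_pmf (th * lam i t) n \<partial>D)"
      if "1 \<le> i" "1 \<le> t" "t \<le> T i" for i t n
      using cond[OF that, of UNIV n] by (simp add: lam_def set_lebesgue_integral_def)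
  qed (use M D D_nonneg D_sq D_mean Tm in \<open>auto simp: lam_def le_SucI\<close>)
  have Lam_eq: "(\<Sum>t\<in>{1..T i}. exp (x i t \<bullet> \<beta>)) = Lam i" for i
    unfolding Lam_def by (simp add: lam_def)
  obtain c where c: "0 < c" "(\<lambda>k. (1 / real k) * (\<Sum>i\<in>{1..k}. (Lam i)\<^sup>2)) \<longlonglongrightarrow> c"
    using lam_lim unfolding Lam_eq by blast
  have tau2: "0 < tau2" using D_var by (simp add: tau2_def)
  obtain Bad where Bad: "\<And>k. Bad k \<in> M.events" "(\<lambda>k. M.prob (Bad k)) \<longlonglongrightarrow> 0"
    and large: "\<forall>\<^sub>F k in sequentially. \<forall>\<omega>\<in>space M - Bad k. \<forall>b. z \<le> T_pin T x k (\<lambda>i t. N i t \<omega>) b"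
    by (rule T_pin_uniformly_large[OF c tau2, where x = x and z = z]) (rule that)
  define R where "R = (\<lambda>k. {\<omega> \<in> space M. T_pin T x k (\<lambda>i t. N i t \<omega>) (\<beta>hat k \<omega>) \<ge> z})"
  \<comment> \<open>Measurability of the estimator makes rejection an event, so that its probability
    can be compared with that of the complement of \<open>Bad k\<close>.\<close>
  have R: "R k \<in> M.events" for k
  proof -
    note [measurable] = mle_meas
    have num: "(\<lambda>\<omega>. \<Sum>i\<in>{1..k}. (\<Sum>t\<in>{1..T i}. real (N i t \<omega>) - exp (x i t \<bullet> \<beta>hat k \<omega>))\<^sup>2
        - (\<Sum>t\<in>{1..T i}. real (N i t \<omega>))) \<in> borel_measurable M"
    proof -
      have "(\<lambda>\<omega>. exp (x i t \<bullet> \<beta>hat k \<omega>)) \<in> borel_measurable M" for i t by measurable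
      moreover have "(\<lambda>\<omega>. real (N i t \<omega>)) \<in> borel_measurable M" if "i \<in> {1..k}" "t \<in> {1..T i}" for i t
        using that by (intro real_N_rv) auto
      ultimately show ?thesis
        by (intro borel_measurable_sum borel_measurable_diff borel_measurable_power)
    qed
    have "(\<lambda>\<omega>. T_pin T x k (\<lambda>i t. N i t \<omega>) (\<beta>hat k \<omega>)) \<in> borel_measurable M"
      unfolding T_pin_def by (intro borel_measurable_divide num) measurable
    then show ?thesis unfolding R_def by measurable
  qed
  have "(\<lambda>k. M.prob (R k)) \<longlonglongrightarrow> 1"
  proof (rule tendsto_sandwich[OF _ _ _ tendsto_const])
    show "(\<lambda>k. 1 - M.prob (Bad k)) \<longlonglongrightarrow> 1"
      using tendsto_diff[OF tendsto_const Bad(2), of 1] by simp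
    show "\<forall>\<^sub>F k in sequentially. 1 - M.prob (Bad k) \<le> M.prob (R k)"
      using large
    proof eventually_elim
      case (elim k)
      then have "space M - Bad k \<subseteq> R k" by (auto simp: R_def)
      then show ?case
        using M.finite_measure_mono[OF _ R, of "space M - Bad k" k] M.prob_compl[OF Bad(1)[of k]] by simp
    qed
  qed simp
  then show ?thesis by (simp add: R_def)
qed

end
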